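(* Let $\mathbb K$ be a field of characteristic zero, let $n\ge 3$, and let $\mathfrak g=\bigoplus_{i\ge 1}\mathfrak g_i$ be a filiform $\mathbb N$-graded Lie algebra over $\mathbb K$, i.e. an $\mathbb N$-graded Lie algebra such that $\dim\mathfrak g_i=1$ for $1\le i\le n$, $\mathfrak g_i=0$ for $i>n$, and $[\mathfrak g_1,\mathfrak g_i]=\mathfrak g_{i+1}$ for all $i\ge 2$. Then $\mathfrak g$ is isomorphic to one and only one Lie algebra from the following list (each algebra is given by a basis and its nonzero brackets, see the context): 1) the Lie algebras of the six sequences $\mathfrak m_0(n)$, $n\ge 3$; $\mathfrak m_2(n)$, $n\ge 5$; $\mathcal V_n$, $n\ge 12$; $\mathfrak m_{0,1}(2k+1)$, $k\ge 3$; $\mathfrak m_{0,2}(2k+2)$, $k\ge 3$; $\mathfrak m_{0,3}(2k+3)$, $k\ge 3$; 2) the Lie algebras of the five one-parameter families $\mathfrak g_{n,\alpha}$ ($\alpha\in\mathbb K$) of dimensions $n=7,\dots,11$: $\mathfrak g_{7,\alpha}$ (no restriction on $\alpha$); $\mathfrak g_{8,\alpha}$ (no restriction on $\alpha$); $\mathfrak g_{9,\alpha}$, $\alpha\ne -\frac52$; $\mathfrak g_{10,\alpha}$, $\alpha\neq-\frac52$; $\mathfrak g_{11,\alpha}$, $\alpha\ne -\frac52,-1,-3$.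
   Context: An $\mathbb N$-graded Lie algebra is a Lie algebra $\mathfrak g=\bigoplus_{i\ge1}\mathfrak g_i$ with $[\mathfrak g_i,\mathfrak g_j]\subset\mathfrak g_{i+j}$. "Isomorphic" means isomorphic as Lie algebras. In each definition below, brackets $[e_i,e_j]$, $i<j$, not listed are zero. $\mathfrak m_0(n)$ (dimension $n$): $[e_1,e_i]=e_{i+1}$, $i=2,\dots,n-1$. $\mathfrak m_2(n)$ (dimension $n$): $[e_1,e_i]=e_{i+1}$, $i=2,\dots,n-1$; $[e_2,e_i]=e_{i+2}$, $i=3,\dots,n-2$. $\mathcal V_n$ (dimension $n$): $[e_i,e_j]=(j-i)e_{i+j}$ if $i+j\le n$, and $0$ if $i+j>n$. $\mathfrak m_{0,1}(2k+1)$ (dimension $2k+1$): $[e_1,e_i]=e_{i+1}$, $i=2,\dots,2k$; $[e_l,e_{2k-l+1}]=(-1)^{l+1}e_{2k+1}$, $l=2,\dots,k$. $\mathfrak m_{0,2}(2k+2)$ (dimension $2k+2$): $[e_1,e_i]=e_{i+1}$, $i=2,\dots,2k+1$; $[e_l,e_{2k-l+1}]=(-1)^{l+1}e_{2k+1}$, $l=2,\dots,k$; $[e_j,e_{2k-j+2}]=(-1)^{j+1}(k-j+1)e_{2k+2}$, $j=2,\dots,k$. $\mathfrak m_{0,3}(2k+3)$ (dimension $2k+3$): $[e_1,e_i]=e_{i+1}$, $i=2,\dots,2k+2$; $[e_l,e_{2k-l+1}]=(-1)^{l+1}e_{2k+1}$, $l=2,\dots,k$; $[e_j,e_{2k-j+2}]=(-1)^{j+1}(k-j+1)e_{2k+2}$,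 $j=2,\dots,k$; $[e_m,e_{2k-m+3}]=(-1)^m\left((m-2)k-\frac{(m-2)(m-1)}2\right)e_{2k+3}$, $m=3,\dots,k+1$. $\mathfrak g_{n,\alpha}$, $n=7,8,9,10,11$ (dimension $n$) has a basis $e_1,\dots,e_n$ and the relations from the first $n-6$ of the following five groups: (1) $[e_1,e_2]=e_3$, $[e_1,e_3]=e_4$, $[e_1,e_4]=e_5$, $[e_1,e_5]=e_6$, $[e_1,e_6]=e_7$, $[e_2,e_3]=(2+\alpha)e_5$, $[e_2,e_4]=(2+\alpha)e_6$, $[e_2,e_5]=(1+\alpha)e_7$, $[e_3,e_4]=e_7$; (2) $[e_1,e_7]=e_8$, $[e_2,e_6]=\alpha e_8$, $[e_3,e_5]=e_8$; (3) $[e_1,e_8]=e_9$, $[e_2,e_7]=\frac{2\alpha^2+3\alpha-2}{2\alpha+5}e_9$, $[e_3,e_6]=\frac{2\alpha+2}{2\alpha+5}e_9$, $[e_4,e_5]=\frac{3}{2\alpha+5}e_9$; (4) $[e_1,e_9]=e_{10}$, $[e_2,e_8]=\frac{2\alpha^2+\alpha-1}{2\alpha+5}e_{10}$, $[e_3,e_7]=\frac{2\alpha-1}{2\alpha+5}e_{10}$, $[e_4,e_6]=\frac3{2\alpha+5}e_{10}$; (5) $[e_1,e_{10}]=e_{11}$, $[e_2,e_9]=\frac{2\alpha^3+2\alpha^2+3}{2(\alpha^2+4\alpha+3)}e_{11}$, $[e_3,e_8]=\frac{4\alpha^3+8\alpha^2-8\alpha-21}{2(\alpha^2+4\alpha+3)(2\alpha+5)}e_{11}$,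 $[e_4,e_7]=\frac{3(2\alpha^2+4\alpha+5)}{2(\alpha^2+4\alpha+3)(2\alpha+5)}e_{11}$, $[e_5,e_6]=\frac{3(4\alpha+1)}{2(\alpha^2+4\alpha+3)(2\alpha+5)}e_{11}$. *)

theory Defs
  imports Complex_Main "HOL-Library.Function_Algebras"
begin

section \<open>Lie algebras and gradings\<close>

text \<open>
  A Lie algebra is bundled into one object so that one can speak of a set of Lie algebras.  The
  underlying vector space is a subspace of a vector space on the whole type; addition is that of
  the type.
\<close>

record ('k, 'v) lie_alg =
  lie_scale :: "'k \<Rightarrow> 'v \<Rightarrow> 'v"
  lie_space :: "'v set"
  lie_bracket :: "'v \<Rightarrow> 'v \<Rightarrow> 'v"

definition lie_algebra :: "('k::field, 'v::ab_group_add) lie_alg \<Rightarrow> bool" where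
  "lie_algebra L \<longleftrightarrow>
     vector_space (lie_scale L) \<and>
     module.subspace (lie_scale L) (lie_space L) \<and>
     (\<forall>x\<in>lie_space L. \<forall>y\<in>lie_space L. lie_bracket L x y \<in> lie_space L) \<and>
     (\<forall>x\<in>lie_space L. \<forall>y\<in>lie_space L. \<forall>z\<in>lie_space L.
        lie_bracket L (x + y) z = lie_bracket L x z + lie_bracket L y z \<and>
        lie_bracket L x (y + z) = lie_bracket L x y + lie_bracket L x z) \<and>
     (\<forall>c. \<forall>x\<in>lie_space L. \<forall>y\<in>lie_space L.
        lie_bracket L (lie_scale L c x) y = lie_scale L c (lie_bracket L x y) \<and>
        lie_bracket L x (lie_scale L c y) = lie_scale L c (lie_bracket L x y)) \<and>
     (\<forall>x\<in>lie_space L. lie_bracket L x x = 0) \<and>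
     (\<forall>x\<in>lie_space L. \<forall>y\<in>lie_space L. \<forall>z\<in>lie_space L.
        lie_bracket L x (lie_bracket L y z) + lie_bracket L y (lie_bracket L z x)
          + lie_bracket L z (lie_bracket L x y) = 0)"

definition lie_isomorphic ::
  "('k, 'v::ab_group_add) lie_alg \<Rightarrow> ('k, 'w::ab_group_add) lie_alg \<Rightarrow> bool" where
  "lie_isomorphic L M \<longleftrightarrow>
     (\<exists>f. bij_betw f (lie_space L) (lie_space M) \<and>
       (\<forall>x\<in>lie_space L. \<forall>y\<in>lie_space L. f (x + y) = f x + f y) \<and>
       (\<forall>c. \<forall>x\<in>lie_space L. f (lie_scale L c x) = lie_scale M c (f x)) \<and>
       (\<forall>x\<in>lie_space L. \<forall>y\<in>lie_space L.
          f (lie_bracket L x y) = lie_bracket M (f x) (f y)))"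

text \<open>The product of two subspaces is the linear span of the brackets, not just their set.\<close>

definition bracket_span :: "('k::field, 'v::ab_group_add) lie_alg \<Rightarrow> 'v set \<Rightarrow> 'v set \<Rightarrow> 'v set" where
  "bracket_span L A B = module.span (lie_scale L) {lie_bracket L x y | x y. x \<in> A \<and> y \<in> B}"

text \<open>
  The space of \<open>L\<close> is the internal direct sum of the subspaces \<open>G i\<close>, \<open>i \<ge> 1\<close> (the value \<open>G 0\<close>
  plays no role), and the bracket respects the grading.
\<close>

definition N_grading :: "('k::field, 'v::ab_group_add) lie_alg \<Rightarrow> (nat \<Rightarrow> 'v set) \<Rightarrow> bool" where
  "N_grading L G \<longleftrightarrow>
     (\<forall>i\<ge>1. module.subspace (lie_scale L) (G i)) \<and>
     module.span (lie_scale L) (\<Union>i\<in>{1..}. G i) = lie_space L \<and>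
     (\<forall>I x. finite I \<and> I \<subseteq> {1..} \<and> (\<forall>i\<in>I. x i \<in> G i) \<and> (\<Sum>i\<in>I. x i) = 0
        \<longrightarrow> (\<forall>i\<in>I. x i = 0)) \<and>
     (\<forall>i\<ge>1. \<forall>j\<ge>1. bracket_span L (G i) (G j) \<subseteq> G (i + j))"


section \<open>Algebras given by a basis and brackets\<close>

definition coord_scale :: "'k::field \<Rightarrow> (nat \<Rightarrow> 'k) \<Rightarrow> (nat \<Rightarrow> 'k)" where
  "coord_scale c x = (\<lambda>m. c * x m)"

definition basis_elt :: "nat \<Rightarrow> nat \<Rightarrow> 'k::field" where
  "basis_elt i = (\<lambda>m. if m = i then 1 else 0)"

text \<open>
  The algebra on \<open>K\<^sup>n\<close>, realised as the functions vanishing outside \<open>{1..n}\<close>, whose bracket is the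
  alternating bilinear extension of \<open>[e\<^sub>i, e\<^sub>j] = B i j\<close> for \<open>1 \<le> i < j \<le> n\<close>.
\<close>

definition table_alg :: "nat \<Rightarrow> (nat \<Rightarrow> nat \<Rightarrow> nat \<Rightarrow> 'k::field) \<Rightarrow> ('k, nat \<Rightarrow> 'k) lie_alg" where
  "table_alg n B =
     \<lparr> lie_scale = coord_scale,
       lie_space = {x. \<forall>m. m \<notin> {1..n} \<longrightarrow> x m = 0},
       lie_bracket = (\<lambda>x y. \<Sum>j=1..n. \<Sum>i=1..<j. coord_scale (x i * y j - x j * y i) (B i j)) \<rparr>"

text \<open>
  All algebras of the list have \<open>[e\<^sub>i, e\<^sub>j] = c i j \<cdot> e\<^bsub>i+j\<^esub>\<close> for \<open>i < j\<close>, \<open>i + j \<le> n\<close>, and \<open>[e\<^sub>i, e\<^sub>j] = 0\<close>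
  for \<open>i + j > n\<close>.  The values \<open>c i j\<close> with \<open>i \<ge> j\<close>, \<open>i = 0\<close> or \<open>i + j > n\<close> are never used, so upper
  bounds such as \<open>i \<le> n - 1\<close> in \<open>[e\<^sub>1, e\<^sub>i] = e\<^bsub>i+1\<^esub>\<close> are not repeated in the coefficients below.
\<close>

definition graded_alg :: "nat \<Rightarrow> (nat \<Rightarrow> nat \<Rightarrow> 'k::field) \<Rightarrow> ('k, nat \<Rightarrow> 'k) lie_alg" where
  "graded_alg n c =
     table_alg n (\<lambda>i j. if i + j \<le> n then coord_scale (c i j) (basis_elt (i + j)) else 0)"

lemma table_alg_bracket_basis:
  assumes "1 \<le> i" "i < j" "j \<le> n"
  shows "lie_bracket (table_alg n B) (basis_elt i) (basis_elt j) = B i j"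
    and "lie_bracket (table_alg n B) (basis_elt j) (basis_elt i) = - B i j"
proof -
  have scale0: "coord_scale 0 x = 0" for x :: "nat \<Rightarrow> 'a"
    by (simp add: coord_scale_def fun_eq_iff)
  have *: "(\<Sum>q=1..n. \<Sum>p=1..<q. coord_scale (s p q) (B p q)) = coord_scale (s i j) (B i j)"
    if s: "\<And>p q. p < q \<Longrightarrow> (p, q) \<noteq> (i, j) \<Longrightarrow> s p q = 0" for s :: "nat \<Rightarrow> nat \<Rightarrow> 'a"
  proof -
    have inner: "(\<Sum>p=1..<q. coord_scale (s p q) (B p q))
        = (if q = j then coord_scale (s i j) (B i j) else 0)" for q
    proof -
      have "(\<Sum>p=1..<q. coord_scale (s p q) (B p q))
          = (\<Sum>p=1..<q. if p = i then if q = j then coord_scale (s i j) (B i j) else 0 else 0)"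
        by (rule sum.cong) (auto simp: s scale0)
      also have "\<dots> = (if q = j then coord_scale (s i j) (B i j) else 0)"
        using assms by (simp add: sum.delta)
      finally show ?thesis .
    qed
    have "(\<Sum>q=1..n. \<Sum>p=1..<q. coord_scale (s p q) (B p q))
        = (\<Sum>q=1..n. if q = j then coord_scale (s i j) (B i j) else 0)"
      by (simp only: inner)
    also have "\<dots> = coord_scale (s i j) (B i j)"
      using assms by (simp add: sum.delta)
    finally show ?thesis .
  qed
  show "lie_bracket (table_alg n B) (basis_elt i) (basis_elt j) = B i j"
    using assms unfolding table_alg_def
    by (simp only: lie_alg.simps, subst *) (auto simp: basis_elt_def coord_scale_def)
  show "lie_bracket (table_alg n B) (basis_elt j) (basis_elt i) = - B i j"
    using assms unfolding table_alg_def
    by (simp only: lie_alg.simps, subst *) (auto simp: basis_elt_def coord_scale_def fun_eq_iff)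
qed


section \<open>The list\<close>

definition m0 :: "nat \<Rightarrow> ('k::field_char_0, nat \<Rightarrow> 'k) lie_alg" where
  "m0 n = graded_alg n (\<lambda>i j. if i = 1 then 1 else 0)"

definition m2 :: "nat \<Rightarrow> ('k::field_char_0, nat \<Rightarrow> 'k) lie_alg" where
  "m2 n = graded_alg n (\<lambda>i j. if i = 1 then 1 else if i = 2 then 1 else 0)"

definition V_alg :: "nat \<Rightarrow> ('k::field_char_0, nat \<Rightarrow> 'k) lie_alg" where
  "V_alg n = graded_alg n (\<lambda>i j. of_nat j - of_nat i)"

text \<open>The argument of \<open>m01\<close>, \<open>m02\<close>, \<open>m03\<close> is \<open>k\<close>; the dimensions are \<open>2k+1\<close>, \<open>2k+2\<close>, \<open>2k+3\<close>.\<close>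

definition m01 :: "nat \<Rightarrow> ('k::field_char_0, nat \<Rightarrow> 'k) lie_alg" where
  "m01 k = graded_alg (2 * k + 1) (\<lambda>i j.
     if i = 1 then 1
     else if i \<in> {2..k} \<and> j = 2 * k + 1 - i then (- 1) ^ (i + 1)
     else 0)"

definition m02 :: "nat \<Rightarrow> ('k::field_char_0, nat \<Rightarrow> 'k) lie_alg" where
  "m02 k = graded_alg (2 * k + 2) (\<lambda>i j.
     if i = 1 then 1
     else if i \<in> {2..k} \<and> j = 2 * k + 1 - i then (- 1) ^ (i + 1)
     else if i \<in> {2..k} \<and> j = 2 * k + 2 - i then
       (- 1) ^ (i + 1) * (of_nat k - of_nat i + 1)
     else 0)"

definition m03 :: "nat \<Rightarrow> ('k::field_char_0, nat \<Rightarrow> 'k) lie_alg" where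
  "m03 k = graded_alg (2 * k + 3) (\<lambda>i j.
     if i = 1 then 1
     else if i \<in> {2..k} \<and> j = 2 * k + 1 - i then (- 1) ^ (i + 1)
     else if i \<in> {2..k} \<and> j = 2 * k + 2 - i then
       (- 1) ^ (i + 1) * (of_nat k - of_nat i + 1)
     else if i \<in> {3..k + 1} \<and> j = 2 * k + 3 - i then
       (- 1) ^ i * ((of_nat i - 2) * of_nat k - (of_nat i - 2) * (of_nat i - 1) / 2)
     else 0)"

text \<open>
  The five groups of relations are those with \<open>i + j \<le> 7\<close> and \<open>i + j = 8, 9, 10, 11\<close>, so the first
  \<open>n - 6\<close> groups are exactly the relations with \<open>i + j \<le> n\<close>, as selected by \<^const>\<open>graded_alg\<close>; in
  particular a denominator only matters from the dimension on in which its group occurs.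
\<close>

definition g_coeff :: "'k::field_char_0 \<Rightarrow> nat \<Rightarrow> nat \<Rightarrow> 'k" where
  "g_coeff \<alpha> i j =
    (if i = 1 then 1
     else if (i, j) = (2, 3) then 2 + \<alpha>
     else if (i, j) = (2, 4) then 2 + \<alpha>
     else if (i, j) = (2, 5) then 1 + \<alpha>
     else if (i, j) = (3, 4) then 1
     else if (i, j) = (2, 6) then \<alpha>
     else if (i, j) = (3, 5) then 1
     else if (i, j) = (2, 7) then (2 * \<alpha>^2 + 3 * \<alpha> - 2) / (2 * \<alpha> + 5)
     else if (i, j) = (3, 6) then (2 * \<alpha> + 2) / (2 * \<alpha> + 5)
     else if (i, j) = (4, 5) then 3 / (2 * \<alpha> + 5)
     else if (i, j) = (2, 8) then (2 * \<alpha>^2 + \<alpha> - 1) / (2 * \<alpha> + 5)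
     else if (i, j) = (3, 7) then (2 * \<alpha> - 1) / (2 * \<alpha> + 5)
     else if (i, j) = (4, 6) then 3 / (2 * \<alpha> + 5)
     else if (i, j) = (2, 9) then
       (2 * \<alpha>^3 + 2 * \<alpha>^2 + 3) / (2 * (\<alpha>^2 + 4 * \<alpha> + 3))
     else if (i, j) = (3, 8) then
       (4 * \<alpha>^3 + 8 * \<alpha>^2 - 8 * \<alpha> - 21) / (2 * (\<alpha>^2 + 4 * \<alpha> + 3) * (2 * \<alpha> + 5))
     else if (i, j) = (4, 7) then
       3 * (2 * \<alpha>^2 + 4 * \<alpha> + 5) / (2 * (\<alpha>^2 + 4 * \<alpha> + 3) * (2 * \<alpha> + 5))
     else if (i, j) = (5, 6) then
       3 * (4 * \<alpha> + 1) / (2 * (\<alpha>^2 + 4 * \<alpha> + 3) * (2 * \<alpha> + 5))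
     else 0)"

definition g_fam :: "nat \<Rightarrow> 'k::field_char_0 \<Rightarrow> ('k, nat \<Rightarrow> 'k) lie_alg" where
  "g_fam n \<alpha> = graded_alg n (g_coeff \<alpha>)"

definition filiform_list :: "('k::field_char_0, nat \<Rightarrow> 'k) lie_alg set" where
  "filiform_list =
     {m0 n | n. n \<ge> 3} \<union> {m2 n | n. n \<ge> 5} \<union> {V_alg n | n. n \<ge> 12} \<union>
     {m01 k | k. k \<ge> 3} \<union> {m02 k | k. k \<ge> 3} \<union> {m03 k | k. k \<ge> 3} \<union>
     {g_fam 7 \<alpha> | \<alpha>. True} \<union>
     {g_fam 8 \<alpha> | \<alpha>. True} \<union>
     {g_fam 9 \<alpha> | \<alpha>. \<alpha> \<noteq> - (5 / 2)} \<union>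
     {g_fam 10 \<alpha> | \<alpha>. \<alpha> \<noteq> - (5 / 2)} \<union>
     {g_fam 11 \<alpha> | \<alpha>. \<alpha> \<noteq> - (5 / 2) \<and> \<alpha> \<noteq> - 1 \<and> \<alpha> \<noteq> - 3}"

text \<open>
  Three algebras are described twice in the list, with literally the same brackets.  They are one
  element of the set \<^const>\<open>filiform_list\<close>, which is what makes a uniqueness claim about members of
  the list (rather than about their descriptions) correct.
\<close>

lemma graded_alg_cong:
  assumes "\<And>i j. 1 \<le> i \<Longrightarrow> i < j \<Longrightarrow> i + j \<le> n \<Longrightarrow> c i j = d i j"
  shows "graded_alg n c = graded_alg n d"
proof -
  let ?B = "\<lambda>c i j. if i + j \<le> n then coord_scale (c i j) (basis_elt (i + j)) else 0"
  have "(\<Sum>j=1..n. \<Sum>i=1..<j. coord_scale (x i * y j - x j * y i) (?B c i j))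
      = (\<Sum>j=1..n. \<Sum>i=1..<j. coord_scale (x i * y j - x j * y i) (?B d i j))" for x y
    by (intro sum.cong refl) (simp add: assms)
  then show ?thesis
    unfolding graded_alg_def table_alg_def by simp
qed

lemma filiform_list_overlaps:
  "m01 3 = g_fam 7 (- 2)" "m02 3 = g_fam 8 (- 2)" "m03 3 = g_fam 9 (- 2)"
proof -
  show "m01 3 = g_fam 7 (- 2)"
    unfolding m01_def g_fam_def
    by (simp, rule graded_alg_cong) (auto simp: g_coeff_def)
  show "m02 3 = g_fam 8 (- 2)"
    unfolding m02_def g_fam_def
    by (simp, rule graded_alg_cong) (auto simp: g_coeff_def)
  show "m03 3 = g_fam 9 (- 2)"
    unfolding m03_def g_fam_def
    by (simp, rule graded_alg_cong) (auto simp: g_coeff_def)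
qed

end

theory Submission
  imports Defs
begin

text \<open>
  A filiform grading has a basis with \<open>[e\<^sub>i, e\<^sub>j] = c i j \<cdot> e\<^bsub>i+j\<^esub>\<close> and \<open>c 1 i = 1\<close>.  The Jacobi identity for
  \<open>e\<^sub>1, e\<^sub>i, e\<^sub>j\<close> reads \<open>c i j = c (i + 1) j + c i (j + 1)\<close>; hence the coefficients with \<open>i + j = N\<close> are
  determined by those with \<open>i + j = N - 1\<close>, up to one free parameter for odd \<open>N\<close>, and the latter is fixed by
  the Jacobi identity for \<open>e\<^sub>2, e\<^sub>3, e\<^bsub>N-5\<^esub>\<close> unless all lower coefficients vanish.  Normalising the first
  nonzero parameter to 1 leaves four branches: \<open>c 3 4 \<noteq> 0\<close> (the families \<open>g\<close>, where \<open>n \<ge> 12\<close> forces the Witt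
  algebra); \<open>c 3 4 = 0 \<noteq> c 2 3\<close> (\<open>m\<^sub>2\<close>); all zero (\<open>m\<^sub>0\<close>); and first nonzero parameter at \<open>N = 2k + 1 \<ge> 9\<close>,
  where the Jacobi identity allows only the dimensions \<open>2k + 1, 2k + 2, 2k + 3\<close>.

  An isomorphism between two such algebras preserves the subspaces \<open>\<langle>e\<^sub>i, \<dots>, e\<^sub>n\<rangle>\<close>, so its diagonal is a
  graded isomorphism, which for \<open>c 1 i = 1\<close> can only multiply all \<open>c i j\<close>, \<open>i, j \<ge> 2\<close>, by a common factor.
\<close>

section \<open>Homomorphisms of graded algebras\<close>

lemma lie_isomorphic_trans:
  assumes "lie_isomorphic L M" "lie_isomorphic M N"
  shows "lie_isomorphic L N"
proof -
  obtain f where f: "bij_betw f (lie_space L) (lie_space M)"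
    "\<forall>x\<in>lie_space L. \<forall>y\<in>lie_space L. f (x + y) = f x + f y"
    "\<forall>c. \<forall>x\<in>lie_space L. f (lie_scale L c x) = lie_scale M c (f x)"
    "\<forall>x\<in>lie_space L. \<forall>y\<in>lie_space L. f (lie_bracket L x y) = lie_bracket M (f x) (f y)"
    using assms(1) unfolding lie_isomorphic_def by blast
  obtain g where g: "bij_betw g (lie_space M) (lie_space N)"
    "\<forall>x\<in>lie_space M. \<forall>y\<in>lie_space M. g (x + y) = g x + g y"
    "\<forall>c. \<forall>x\<in>lie_space M. g (lie_scale M c x) = lie_scale N c (g x)"
    "\<forall>x\<in>lie_space M. \<forall>y\<in>lie_space M. g (lie_bracket M x y) = lie_bracket N (g x) (g y)"
    using assms(2) unfolding lie_isomorphic_def by blast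
  have "f x \<in> lie_space M" if "x \<in> lie_space L" for x
    using f(1) that by (auto simp: bij_betw_def)
  then show ?thesis
    unfolding lie_isomorphic_def using f g bij_betw_trans[OF f(1) g(1)]
    by (intro exI[of _ "g \<circ> f"]) auto
qed

text \<open>\<open>lie_isomorphic\<close> constrains a map only on the space of its source. The laws
  for the inverse are pulled back along f, which requires sums, multiples and brackets to stay in
  that space; hence the closure assumptions.\<close>

lemma lie_isomorphic_sym:
  assumes iso: "lie_isomorphic L M"
    and closed: "\<And>x y. x \<in> lie_space L \<Longrightarrow> y \<in> lie_space L \<Longrightarrow> x + y \<in> lie_space L"
      "\<And>c x. x \<in> lie_space L \<Longrightarrow> lie_scale L c x \<in> lie_space L"
      "\<And>x y. x \<in> lie_space L \<Longrightarrow> y \<in> lie_space L \<Longrightarrow> lie_bracket L x y \<in> lie_space L"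
  shows "lie_isomorphic M L"
proof -
  obtain f where f: "bij_betw f (lie_space L) (lie_space M)"
    "\<And>x y. x\<in>lie_space L \<Longrightarrow> y\<in>lie_space L \<Longrightarrow> f (x + y) = f x + f y"
    "\<And>c x. x\<in>lie_space L \<Longrightarrow> f (lie_scale L c x) = lie_scale M c (f x)"
    "\<And>x y. x\<in>lie_space L \<Longrightarrow> y\<in>lie_space L \<Longrightarrow> f (lie_bracket L x y) = lie_bracket M (f x) (f y)"
    using iso unfolding lie_isomorphic_def by blast
  define g where "g = the_inv_into (lie_space L) f"
  have g: "bij_betw g (lie_space M) (lie_space L)"
    unfolding g_def by (rule bij_betw_the_inv_into[OF f(1)])
  have gf: "g (f x) = x" if "x \<in> lie_space L" for x
    unfolding g_def using f(1) that by (simp add: bij_betw_def the_inv_into_f_f)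
  have fg: "\<exists>x \<in> lie_space L. y = f x" if "y \<in> lie_space M" for y
    using f(1) that by (auto simp: bij_betw_def)
  show ?thesis
    unfolding lie_isomorphic_def
  proof (intro exI[of _ g] conjI ballI allI g)
    fix x y assume "x \<in> lie_space M" "y \<in> lie_space M"
    then obtain u v where u: "u \<in> lie_space L" "x = f u" and v: "v \<in> lie_space L" "y = f v"
      using fg by blast
    show "g (x + y) = g x + g y"
      using u v closed(1) by (simp add: gf flip: f(2))
    show "g (lie_bracket M x y) = lie_bracket L (g x) (g y)"
      using u v closed(3) by (simp add: gf flip: f(4))
  next
    fix c x assume "x \<in> lie_space M"
    then obtain u where "u \<in> lie_space L" "x = f u"
      using fg by blast
    then show "g (lie_scale M c x) = lie_scale L c (g x)"
      using closed(2) by (simp add: gf flip: f(3))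
  qed
qed

section \<open>Coordinates and degrees in graded algebras\<close>

lemma lie_scale_graded [simp]: "lie_scale (graded_alg n c) = coord_scale"
  by (simp add: graded_alg_def table_alg_def)

lemma lie_space_graded: "lie_space (graded_alg n c) = {x. \<forall>m. m \<notin> {1..n} \<longrightarrow> x m = 0}"
  by (simp add: graded_alg_def table_alg_def)

lemma sum_fun_apply: "(\<Sum>i\<in>A. f i) x = (\<Sum>i\<in>A. f i x)"
  by (induction A rule: infinite_finite_induct) auto

lemma lie_bracket_graded:
  "lie_bracket (graded_alg n c) x y m =
     (\<Sum>j=1..n. \<Sum>i=1..<j. if i + j \<le> n \<and> m = i + j then (x i * y j - x j * y i) * c i j else 0)"
  unfolding graded_alg_def table_alg_def
  by (simp add: sum_fun_apply coord_scale_def basis_elt_def cong: if_cong) (intro sum.cong refl, auto)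

lemma lie_space_graded_add:
  "x \<in> lie_space (graded_alg n c) \<Longrightarrow> y \<in> lie_space (graded_alg n c) \<Longrightarrow> x + y \<in> lie_space (graded_alg n c)"
  by (auto simp: lie_space_graded)

lemma lie_space_graded_scale:
  "x \<in> lie_space (graded_alg n c) \<Longrightarrow> coord_scale a x \<in> lie_space (graded_alg n c)"
  by (auto simp: lie_space_graded coord_scale_def)

lemma lie_space_graded_bracket: "lie_bracket (graded_alg n c) x y \<in> lie_space (graded_alg n c)"
  unfolding lie_space_graded by (auto simp: lie_bracket_graded intro!: sum.neutral)

lemma lie_isomorphic_graded_sym:
  "lie_isomorphic (graded_alg n c) M \<Longrightarrow> lie_isomorphic M (graded_alg n c)"
  by (rule lie_isomorphic_sym)
    (simp_all add: lie_space_graded_add lie_space_graded_scale lie_space_graded_bracket)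

lemma basis_elt_in_graded: "1 \<le> i \<Longrightarrow> i \<le> n \<Longrightarrow> basis_elt i \<in> lie_space (graded_alg n c)"
  by (auto simp: lie_space_graded basis_elt_def)

lemma bracket_basis_graded:
  assumes "1 \<le> i" "i < j" "i + j \<le> n"
  shows "lie_bracket (graded_alg n c) (basis_elt i) (basis_elt j) = coord_scale (c i j) (basis_elt (i + j))"
  unfolding graded_alg_def using assms by (subst table_alg_bracket_basis) auto

text \<open>A contributing term pairs coordinate i of one vector with coordinate j of the other,
  where i + j = m < p + q. Then one of the two lies below its leading index and the product
  vanishes.\<close>

lemma bracket_graded_low:
  assumes "\<And>i. i < p \<Longrightarrow> x i = 0" "\<And>i. i < q \<Longrightarrow> y i = 0" "m < p + q"
  shows "lie_bracket (graded_alg n c) x y m = 0"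
  unfolding lie_bracket_graded
proof (intro sum.neutral ballI)
  fix j i
  have "x i * y j = 0 \<and> x j * y i = 0" if "m = i + j"
    using assms that by (metis add.commute add_le_mono linorder_not_less mult_eq_0_iff)
  then show "(if i + j \<le> n \<and> m = i + j then (x i * y j - x j * y i) * c i j else 0) = 0"
    by auto
qed

text \<open>In degree p + q an index above the leading one in one factor forces an index below it in
  the other, so only x p * y q survives. Because p < q, the reversed products x j * y i all have i <
  q and vanish too.\<close>

lemma bracket_graded_lead:
  assumes x: "\<And>i. i < p \<Longrightarrow> x i = 0" and y: "\<And>i. i < q \<Longrightarrow> y i = 0"
    and "1 \<le> p" "p < q" "p + q \<le> n"
  shows "lie_bracket (graded_alg n c) x y (p + q) = x p * y q * c p q"
proof -
  have "lie_bracket (graded_alg n c) x y (p + q)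
      = (\<Sum>j=1..n. \<Sum>i=1..<j. if i = p then if j = q then x p * y q * c p q else 0 else 0)"
    unfolding lie_bracket_graded
  proof (intro sum.cong refl)
    fix j i assume ij: "j \<in> {1..n}" "i \<in> {1..<j}"
    show "(if i + j \<le> n \<and> p + q = i + j then (x i * y j - x j * y i) * c i j else 0)
        = (if i = p then if j = q then x p * y q * c p q else 0 else 0)"
    proof (cases "p + q = i + j")
      case True
      then have "j > p" using ij assms by auto
      then have "i < q" using True by auto
      then have "y i = 0" by (rule y)
      moreover have "x i * y j = 0" if "i \<noteq> p"
        using that True x[of i] y[of j] by (cases "i < p") auto
      ultimately show ?thesis
        using True assms by auto
    qed (use assms in auto)
  qed
  also have "\<dots> = (\<Sum>j=1..n. if j = q then x p * y q * c p q else 0)"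
    using assms by (intro sum.cong refl) (auto simp: sum.delta)
  also have "\<dots> = x p * y q * c p q"
    using assms by (simp add: sum.delta)
  finally show ?thesis .
qed

text \<open>A change of the basis vectors \<open>e\<^sub>i\<close> into nonzero multiples \<open>\<mu> i \<cdot> e\<^sub>i\<close>.\<close>

definition coeff_equiv :: "nat \<Rightarrow> (nat \<Rightarrow> nat \<Rightarrow> 'k::field) \<Rightarrow> (nat \<Rightarrow> nat \<Rightarrow> 'k) \<Rightarrow> bool" where
  "coeff_equiv n c d \<longleftrightarrow> (\<exists>\<mu>. (\<forall>i\<in>{1..n}. \<mu> i \<noteq> 0) \<and>
     (\<forall>i j. 1 \<le> i \<longrightarrow> i < j \<longrightarrow> i + j \<le> n \<longrightarrow> c i j * \<mu> (i + j) = \<mu> i * \<mu> j * d i j))"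

text \<open>The isomorphism is diagonal: it multiplies coordinate m by \<open>\<mu> m\<close>, and
  the defining equation of \<open>coeff_equiv\<close> compares the images of the brackets of basis
  vectors.\<close>

lemma coeff_equiv_isomorphic:
  assumes "coeff_equiv n c d"
  shows "lie_isomorphic (graded_alg n c) (graded_alg n d)"
proof -
  obtain \<mu> where nz: "\<And>i. i \<in> {1..n} \<Longrightarrow> \<mu> i \<noteq> 0"
    and eq: "\<And>i j. 1 \<le> i \<Longrightarrow> i < j \<Longrightarrow> i + j \<le> n \<Longrightarrow> c i j * \<mu> (i + j) = \<mu> i * \<mu> j * d i j"
    using assms unfolding coeff_equiv_def by blast
  define f where "f x m = \<mu> m * x m" for x :: "nat \<Rightarrow> 'a" and m
  have "(\<lambda>m. f x m / \<mu> m) = x" "f (\<lambda>m. x m / \<mu> m) = x" if "x \<in> lie_space (graded_alg n c)" for x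
  proof -
    have "\<mu> m * x m / \<mu> m = x m" "\<mu> m * (x m / \<mu> m) = x m" for m
      using that nz[of m] by (cases "m \<in> {1..n}"; simp add: lie_space_graded)+
    then show "(\<lambda>m. f x m / \<mu> m) = x" "f (\<lambda>m. x m / \<mu> m) = x"
      by (simp_all add: f_def fun_eq_iff)
  qed
  then have "bij_betw f (lie_space (graded_alg n c)) (lie_space (graded_alg n d))"
    by (intro bij_betw_byWitness[where f' = "\<lambda>x m. x m / \<mu> m"])
      (auto simp: lie_space_graded f_def)
  moreover have "f (lie_bracket (graded_alg n c) x y) = lie_bracket (graded_alg n d) (f x) (f y)" for x y
  proof
    fix m
    have "(if i + j \<le> n \<and> m = i + j then \<mu> m * ((x i * y j - x j * y i) * c i j) else 0) =
       (if i + j \<le> n \<and> m = i + j then (f x i * f y j - f x j * f y i) * d i j else 0)"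
      if "j \<in> {1..n}" "i \<in> {1..<j}" for i j
    proof (cases "i + j \<le> n \<and> m = i + j")
      case True
      have "\<mu> m * ((x i * y j - x j * y i) * c i j) = (x i * y j - x j * y i) * (c i j * \<mu> (i + j))"
        using True by simp
      also have "c i j * \<mu> (i + j) = \<mu> i * \<mu> j * d i j"
        using True that by (intro eq) auto
      finally show ?thesis
        using True by (simp add: f_def algebra_simps)
    qed auto
    then show "f (lie_bracket (graded_alg n c) x y) m = lie_bracket (graded_alg n d) (f x) (f y) m"
      unfolding f_def[of "lie_bracket _ x y"] lie_bracket_graded sum_distrib_left
      by (intro sum.cong refl) (simp only: if_distrib[of "(*) _"] mult_zero_right)
  qed
  ultimately show ?thesis
    unfolding lie_isomorphic_def
    by (intro exI[of _ f]) (auto simp: f_def coord_scale_def fun_eq_iff algebra_simps)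
qed

section \<open>Triangularity of isomorphisms between graded algebras\<close>

text \<open>Stated for a homomorphism with possibly different dimensions, so that an isomorphism and
  its inverse can both be instances.\<close>

locale graded_hom =
  fixes n m :: nat and c d :: "nat \<Rightarrow> nat \<Rightarrow> 'k::field" and f :: "(nat \<Rightarrow> 'k) \<Rightarrow> nat \<Rightarrow> 'k"
  assumes dim: "3 \<le> n"
    and c1: "2 \<le> i \<Longrightarrow> i < n \<Longrightarrow> c 1 i \<noteq> 0"
    and f_space: "x \<in> lie_space (graded_alg n c) \<Longrightarrow> f x \<in> lie_space (graded_alg m d)"
    and f_add: "x \<in> lie_space (graded_alg n c) \<Longrightarrow> y \<in> lie_space (graded_alg n c) \<Longrightarrow> f (x + y) = f x + f y"
    and f_scale: "x \<in> lie_space (graded_alg n c) \<Longrightarrow> f (coord_scale a x) = coord_scale a (f x)"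
    and f_bracket: "x \<in> lie_space (graded_alg n c) \<Longrightarrow> y \<in> lie_space (graded_alg n c) \<Longrightarrow>
      f (lie_bracket (graded_alg n c) x y) = lie_bracket (graded_alg m d) (f x) (f y)"
begin

lemma f_zero: "f 0 = 0"
proof -
  have "f (coord_scale 0 0) = coord_scale 0 (f 0)"
    by (rule f_scale) (simp add: lie_space_graded)
  then show ?thesis
    by (simp add: coord_scale_def zero_fun_def)
qed

lemma f_vanish_0: "x \<in> lie_space (graded_alg n c) \<Longrightarrow> f x 0 = 0"
  using f_space by (force simp: lie_space_graded)

lemma f_basis_bracket:
  assumes "1 \<le> i" "i < j" "i + j \<le> n"
  shows "lie_bracket (graded_alg m d) (f (basis_elt i)) (f (basis_elt j)) k = c i j * f (basis_elt (i + j)) k"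
proof -
  have "lie_bracket (graded_alg m d) (f (basis_elt i)) (f (basis_elt j))
      = f (lie_bracket (graded_alg n c) (basis_elt i) (basis_elt j))"
    using assms by (intro f_bracket[symmetric] basis_elt_in_graded) auto
  also have "\<dots> = coord_scale (c i j) (f (basis_elt (i + j)))"
    using assms by (simp add: bracket_basis_graded f_scale basis_elt_in_graded)
  finally show ?thesis
    by (simp add: coord_scale_def)
qed

text \<open>The terms \<open>\<langle>e\<^sub>3, \<dots>, e\<^sub>n\<rangle>, \<langle>e\<^sub>4, \<dots>, e\<^sub>n\<rangle>, \<dots>\<close> of the lower central series are preserved.\<close>

lemma f_basis_low:
  assumes "3 \<le> i" "i \<le> n" "k < i"
  shows "f (basis_elt i) k = 0"
  using assms
proof (induction i arbitrary: k rule: dec_induct)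
  case base
  have "lie_bracket (graded_alg m d) (f (basis_elt 1)) (f (basis_elt 2)) k = 0"
  proof (cases "k = 0")
    case True
    then show ?thesis
      using bracket_graded_low[of 0 _ 1 _ k] dim f_vanish_0[OF basis_elt_in_graded, of 2] by simp
  next
    case False
    \<comment> \<open>With 1 \<le> i < j the degree i + j is at least 3, so every bracket vanishes
      in the coordinates below 3.\<close>
    have "(if i + j \<le> m \<and> k = i + j then X else 0) = 0" if "j \<in> {1..m}" "i \<in> {1..<j}" for i j and X :: 'k
      using that base by auto
    then show ?thesis
      unfolding lie_bracket_graded by (intro sum.neutral ballI) auto
  qed
  then show ?case
    using f_basis_bracket[of 1 2 k] c1[of 2] dim by (simp add: numeral_eq_Suc)
next
  case (step i)
  have "lie_bracket (graded_alg m d) (f (basis_elt 1)) (f (basis_elt i)) k = 0"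
    using step f_vanish_0[OF basis_elt_in_graded, of 1] by (intro bracket_graded_low[of 1 _ i]) auto
  then show ?case
    using f_basis_bracket[of 1 i k] c1[of i] step by simp
qed

text \<open>Linearity carries the vanishing from basis vectors to all vectors: the lowest coordinate
  is split off, by induction downwards from q = n + 1, where the vector is 0.\<close>

lemma f_low:
  assumes "1 \<le> p" and p: "\<And>i k. p \<le> i \<Longrightarrow> i \<le> n \<Longrightarrow> k < p \<Longrightarrow> f (basis_elt i) k = 0"
    and x: "x \<in> lie_space (graded_alg n c)" "\<And>i. i < p \<Longrightarrow> x i = 0" and k: "k < p"
  shows "f x k = 0"
proof -
  have "f x k = 0" if "q \<le> n + 1" "p \<le> q" "x \<in> lie_space (graded_alg n c)" "\<And>i. i < q \<Longrightarrow> x i = 0" for q x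
    using that
  proof (induction q arbitrary: x rule: inc_induct)
    case base
    then have "x i = 0" for i
      by (cases "i < n + 1") (auto simp: lie_space_graded)
    then have "x = 0"
      by (simp add: fun_eq_iff)
    then show ?case
      unfolding \<open>x = 0\<close> f_zero by simp
  next
    case (step q)
    define y where "y = (\<lambda>m. if m = q then 0 else x m)"
    have e: "basis_elt q \<in> lie_space (graded_alg n c)"
      using step.hyps step.prems assms(1) by (intro basis_elt_in_graded) auto
    have y: "y \<in> lie_space (graded_alg n c)" "y i = 0" if "i < Suc q" for i
      using step.prems that by (auto simp: y_def lie_space_graded less_Suc_eq)
    have "x = coord_scale (x q) (basis_elt q) + y"
      by (auto simp: fun_eq_iff y_def coord_scale_def basis_elt_def)
    then have "f x = coord_scale (x q) (f (basis_elt q)) + f y"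
      using e y(1)[of 0] by (metis f_add f_scale lie_space_graded_scale zero_less_Suc)
    moreover have "f y k = 0"
      using step.prems y by (intro step.IH) auto
    moreover have "f (basis_elt q) k = 0"
      using step.hyps step.prems k by (intro p) auto
    ultimately show ?case
      by (simp add: coord_scale_def)
  qed
  from this[of p x] show ?thesis
  proof (cases "p \<le> n + 1")
    case False
    have "x i = 0" for i
      using x False by (cases "i < p") (auto simp: lie_space_graded)
    then have "x = 0"
      by (simp add: fun_eq_iff)
    then show ?thesis
      unfolding \<open>x = 0\<close> f_zero by simp
  qed (use x in auto)
qed

end

text \<open>Only g after f is required to be the identity; the other composition is the same locale
  with f and g exchanged, and \<open>graded_isoI\<close> provides both.\<close>

locale graded_iso =
  f: graded_hom n m c d f + g: graded_hom m n d c g for n m c d f g +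
  assumes gf: "x \<in> lie_space (graded_alg n c) \<Longrightarrow> g (f x) = x"
begin

text \<open>The image of e_n lives in degrees at least n. If m < n there are none in the target, so
  e_n would be mapped to 0, against injectivity.\<close>

lemma dim_le: "n \<le> m"
proof (rule ccontr)
  assume "\<not> n \<le> m"
  have e: "basis_elt n \<in> lie_space (graded_alg n c)"
    using f.dim by (intro basis_elt_in_graded) auto
  have "f (basis_elt n) k = 0" for k
    using f.f_basis_low[of n k] f.dim f.f_space[OF e] \<open>\<not> n \<le> m\<close> by (cases "k < n") (auto simp: lie_space_graded)
  then have "f (basis_elt n) = 0"
    by (simp add: fun_eq_iff)
  then have "basis_elt n = (0 :: nat \<Rightarrow> 'a)"
    using gf[OF e] g.f_zero by simp
  then have "basis_elt n n = (0 :: 'a)"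
    by simp
  then show False
    by (simp add: basis_elt_def)
qed

text \<open>Otherwise f e_i would start beyond degree i, g would keep it there, and g (f e_i) could
  not be e_i.\<close>

lemma diagonal_nonzero:
  assumes "1 \<le> i" "i \<le> n" and f: "\<And>k. k < i \<Longrightarrow> f (basis_elt i) k = 0"
    and g: "\<And>j k. i < j \<Longrightarrow> j \<le> m \<Longrightarrow> k \<le> i \<Longrightarrow> g (basis_elt j) k = 0"
  shows "f (basis_elt i) i \<noteq> 0"
proof
  assume "f (basis_elt i) i = 0"
  then have *: "f (basis_elt i) k = 0" if "k < Suc i" for k
    using f that less_Suc_eq by auto
  have e: "basis_elt i \<in> lie_space (graded_alg n c)"
    using assms by (intro basis_elt_in_graded) auto
  have "g (f (basis_elt i)) i = 0"
    by (rule g.f_low[of "Suc i"]) (use g * f.f_space[OF e] in auto)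
  then have "basis_elt i i = (0 :: 'a)"
    unfolding gf[OF e] .
  then show False
    by (simp add: basis_elt_def)
qed

text \<open>
  Since \<open>[e\<^sub>2, e\<^sub>3]\<close> lies in \<open>\<langle>e\<^sub>5, \<dots>\<rangle>\<close> whereas \<open>[e\<^sub>1, e\<^sub>3]\<close> does not, \<open>\<langle>e\<^sub>2, \<dots>, e\<^sub>n\<rangle>\<close> is preserved as well.
\<close>

lemma f_basis_low_2:
  assumes "4 \<le> n" "2 \<le> i" "i \<le> n" "k < i"
  shows "f (basis_elt i) k = 0"
proof (cases "3 \<le> i")
  case True
  then show ?thesis
    using f.f_basis_low assms by blast
next
  case False
  then have i: "i = 2"
    using assms by simp
  have m: "4 \<le> m"
    using dim_le assms by simp
  have e: "basis_elt i \<in> lie_space (graded_alg n c)" if "1 \<le> i" "i \<le> n" for i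
    using that by (rule basis_elt_in_graded)
  have nz: "f (basis_elt 3) 3 \<noteq> 0"
    using assms f.f_basis_low g.f_basis_low by (intro diagonal_nonzero) auto
  \<comment> \<open>The degree 4 coordinate of [f e_2, f e_3] isolates the e_1-component of f e_2,
    multiplied by two nonzero factors.\<close>
  have "f (basis_elt 2) 1 * f (basis_elt 3) 3 * d 1 3
      = lie_bracket (graded_alg m d) (f (basis_elt 2)) (f (basis_elt 3)) (1 + 3)"
    using assms m f.f_vanish_0 e f.f_basis_low[of 3] by (intro bracket_graded_lead[symmetric]) auto
  also have "\<dots> = 0"
  proof (cases "5 \<le> n")
    case True
    then show ?thesis
      using f.f_basis_bracket[of 2 3 4] f.f_basis_low[of 5 4] by simp
  next
    case False
    \<comment> \<open>In dimension 4 there is no e_5; the bracket of e_2 and e_3 is itself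
      0.\<close>
    then have "n = 4" using assms by simp
    have "lie_bracket (graded_alg n c) (basis_elt 2) (basis_elt 3) = 0"
      using \<open>n = 4\<close> unfolding graded_alg_def by (subst table_alg_bracket_basis) auto
    then have "f (lie_bracket (graded_alg n c) (basis_elt 2) (basis_elt 3)) = 0"
      by (simp add: f.f_zero)
    then show ?thesis
      using f.f_bracket[OF e e, of 2 3] \<open>n = 4\<close> by simp
  qed
  finally have "f (basis_elt 2) 1 = 0"
    using nz g.c1[of 3] m by simp
  then show ?thesis
    using f.f_vanish_0[OF e, of 2] assms i by (cases "k = 0") (auto simp: less_2_cases_iff)
qed

end

lemma graded_isoI:
  assumes iso: "lie_isomorphic (graded_alg n c) (graded_alg m d)"
    and "3 \<le> n" "3 \<le> m" "\<And>i. 2 \<le> i \<Longrightarrow> i < n \<Longrightarrow> c 1 i \<noteq> 0" "\<And>i. 2 \<le> i \<Longrightarrow> i < m \<Longrightarrow> d 1 i \<noteq> 0"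
  obtains f g where "graded_iso n m c d f g" "graded_iso m n d c g f"
proof -
  let ?L = "graded_alg n c" and ?M = "graded_alg m d"
  obtain f where f: "bij_betw f (lie_space ?L) (lie_space ?M)"
    "\<And>x y. x\<in>lie_space ?L \<Longrightarrow> y\<in>lie_space ?L \<Longrightarrow> f (x + y) = f x + f y"
    "\<And>a x. x\<in>lie_space ?L \<Longrightarrow> f (coord_scale a x) = coord_scale a (f x)"
    "\<And>x y. x\<in>lie_space ?L \<Longrightarrow> y\<in>lie_space ?L \<Longrightarrow> f (lie_bracket ?L x y) = lie_bracket ?M (f x) (f y)"
    using iso unfolding lie_isomorphic_def lie_scale_graded by blast
  define g where "g = the_inv_into (lie_space ?L) f"
  have gf: "g (f x) = x" if "x \<in> lie_space ?L" for x
    unfolding g_def using f(1) that by (simp add: bij_betw_def the_inv_into_f_f)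
  have fg: "\<exists>x \<in> lie_space ?L. y = f x" if "y \<in> lie_space ?M" for y
    using f(1) that by (auto simp: bij_betw_def)
  have fM: "f x \<in> lie_space ?M" if "x \<in> lie_space ?L" for x
    using f(1) that by (auto simp: bij_betw_def)
  have F: "graded_hom n m c d f"
    by unfold_locales (use assms f fM in auto)
  have G: "graded_hom m n d c g"
  proof unfold_locales
    fix x y assume "x \<in> lie_space ?M" "y \<in> lie_space ?M"
    then obtain u v where u: "u \<in> lie_space ?L" "x = f u" and v: "v \<in> lie_space ?L" "y = f v"
      using fg by blast
    show "g (x + y) = g x + g y"
      using u v by (simp add: gf lie_space_graded_add flip: f(2))
    show "g (lie_bracket ?M x y) = lie_bracket ?L (g x) (g y)"
      using u v by (simp add: gf lie_space_graded_bracket flip: f(4))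
  next
    fix a x assume "x \<in> lie_space ?M"
    then obtain u where u: "u \<in> lie_space ?L" "x = f u"
      using fg by blast
    show "g (coord_scale a x) = coord_scale a (g x)"
      using u by (simp add: gf lie_space_graded_scale flip: f(3))
    show "g x \<in> lie_space ?L"
      using u by (simp add: gf)
  qed (use assms in auto)
  have "graded_iso n m c d f g"
    by (intro graded_iso.intro F G) (unfold_locales, simp add: gf)
  moreover have "f (g y) = y" if "y \<in> lie_space ?M" for y
    using fg[OF that] gf by auto
  then have "graded_iso m n d c g f"
    by (intro graded_iso.intro F G) (unfold_locales, simp)
  ultimately show ?thesis
    using that by blast
qed

text \<open>The diagonal entries of the triangular map f serve as \<open>\<mu>\<close>: the leading
  coordinate of f [e_i, e_j] is computed on both sides. Dimension 3 is set apart because the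
  Heisenberg algebra has automorphisms that mix e_1 and e_2.\<close>

theorem graded_isomorphic_coeff_equiv:
  assumes iso: "lie_isomorphic (graded_alg n c) (graded_alg m d)"
    and nm: "3 \<le> n" "3 \<le> m"
    and c1: "\<And>i. 2 \<le> i \<Longrightarrow> i < n \<Longrightarrow> c 1 i \<noteq> 0" and d1: "\<And>i. 2 \<le> i \<Longrightarrow> i < m \<Longrightarrow> d 1 i \<noteq> 0"
  shows "n = m" "4 \<le> n \<Longrightarrow> coeff_equiv n c d"
proof -
  obtain f g where fg: "graded_iso n m c d f g" and gf: "graded_iso m n d c g f"
    using graded_isoI[OF assms] by blast
  interpret fg: graded_iso n m c d f g by (rule fg)
  interpret gf: graded_iso m n d c g f by (rule gf)
  show nm: "n = m"
    using fg.dim_le gf.dim_le by simp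
  assume 4: "4 \<le> n"
  have low: "f (basis_elt i) k = 0" if "1 \<le> i" "i \<le> n" "k < i" for i k
    using that fg.f_basis_low_2[of i k] fg.f.f_vanish_0[OF basis_elt_in_graded, of i] 4
    by (cases "i = 1") auto
  have nz: "f (basis_elt i) i \<noteq> 0" if "i \<in> {1..n}" for i
    using that low gf.f_basis_low_2 4 nm by (intro fg.diagonal_nonzero) auto
  have "c i j * f (basis_elt (i + j)) (i + j) = f (basis_elt i) i * f (basis_elt j) j * d i j"
    if "1 \<le> i" "i < j" "i + j \<le> n" for i j
    using fg.f.f_basis_bracket[OF that, of "i + j"] that nm low
      bracket_graded_lead[of i "f (basis_elt i)" j "f (basis_elt j)" m d]
    by simp
  then show "coeff_equiv n c d"
    unfolding coeff_equiv_def using nz by (intro exI[of _ "\<lambda>i. f (basis_elt i) i"]) auto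
qed

section \<open>Coefficients of filiform algebras\<close>

text \<open>Structure constants as a function of all pairs of indices. Antisymmetry is demanded even
  for i + j > n, where \<open>graded_coefficients\<close> will choose the value 0.\<close>

locale filiform_coeffs =
  fixes n :: nat and c :: "nat \<Rightarrow> nat \<Rightarrow> 'k::field_char_0"
  assumes anti: "c i j = - c j i"
    and one: "2 \<le> i \<Longrightarrow> i < n \<Longrightarrow> c 1 i = 1"
    and jacobi: "1 \<le> i \<Longrightarrow> 1 \<le> j \<Longrightarrow> 1 \<le> k \<Longrightarrow> i + j + k \<le> n \<Longrightarrow>
      c j k * c i (j + k) + c k i * c j (k + i) + c i j * c k (i + j) = 0"
begin

lemma diag [simp]: "c i i = 0"
  using anti[of i i] by (simp add: eq_neg_iff_add_eq_0 flip: mult_2)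

lemma rec:
  assumes "2 \<le> i" "2 \<le> j" "i + j < n"
  shows "c i j = c (i + 1) j + c i (j + 1)"
proof -
  have 1: "c 1 i = 1" "c 1 j = 1" "c 1 (i + j) = 1"
    using assms by (auto intro!: one simp del: One_nat_def)
  have "c i j * c 1 (i + j) + c j 1 * c i (j + 1) + c 1 i * c j (1 + i) = 0"
    using assms by (intro jacobi) auto
  then show ?thesis
    using 1 anti[of j 1] anti[of j "i + 1"] by (simp add: algebra_simps)
qed

text \<open>The three coefficients of level N occur linearly, each multiplied by a coefficient of a
  lower level. The free parameter of an odd level therefore satisfies a linear equation.\<close>

lemma jacobi_23:
  assumes "8 \<le> N" "N \<le> n"
  shows "c 3 (N - 5) * c 2 (N - 2) - c 2 (N - 5) * c 3 (N - 3) - c 2 3 * c 5 (N - 5) = 0"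
proof -
  have "c 3 (N - 5) * c 2 (3 + (N - 5)) + c (N - 5) 2 * c 3 (N - 5 + 2)
      + c 2 3 * c (N - 5) (2 + 3) = 0"
    using assms by (intro jacobi) auto
  moreover have "3 + (N - 5) = N - 2" "N - 5 + 2 = N - 3"
    using assms by auto
  ultimately show ?thesis
    using anti[of "N - 5" 2] anti[of "N - 5" 5] by simp
qed

text \<open>
  The coefficients with \<open>i + j = N\<close> are determined by those with \<open>i + j = N - 1\<close>, up to one free
  parameter when \<open>N\<close> is odd: \<open>f i\<close> stands for a candidate for \<open>c i (N - i)\<close>.
\<close>

lemma level:
  assumes "N \<le> n" and f: "\<And>i. 2 \<le> i \<Longrightarrow> i + 3 \<le> N \<Longrightarrow> c i (N - 1 - i) = f (i + 1) + f i"
  obtains t where "\<And>i. 2 \<le> i \<Longrightarrow> i + 2 \<le> N \<Longrightarrow> c i (N - i) = f i + (-1) ^ i * t"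
proof
  fix i assume "2 \<le> i" "i + 2 \<le> N"
  \<comment> \<open>The parameter t is the error at i = 2. Since c and f satisfy the same recursion,
    the error c i (N - i) - f i only changes sign from one i to the next.\<close>
  then show "c i (N - i) = f i + (-1) ^ i * (c 2 (N - 2) - f 2)"
  proof (induction i rule: dec_induct)
    case base
    then show ?case by simp
  next
    case (step i)
    have "c i (N - 1 - i) = c (i + 1) (N - 1 - i) + c i (N - 1 - i + 1)"
      using step.hyps step.prems assms(1) by (intro rec) auto
    moreover have "N - 1 - i + 1 = N - i" "N - 1 - i = N - Suc i"
      using step.prems by auto
    moreover have "c i (N - 1 - i) = f (i + 1) + f i"
      using step.hyps step.prems by (intro f) auto
    ultimately show ?case
      using step.IH step.prems by (simp add: algebra_simps)
  qed
qed

text \<open>The middle coefficient c m m vanishes by antisymmetry, and so does f m, which forces t =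
  0.\<close>

lemma level_even:
  assumes "N \<le> n" "N = 2 * m" and "f m = 0"
    and f: "\<And>i. 2 \<le> i \<Longrightarrow> i + 3 \<le> N \<Longrightarrow> c i (N - 1 - i) = f (i + 1) + f i"
    and i: "2 \<le> i" "i + 2 \<le> N"
  shows "c i (N - i) = f i"
proof -
  obtain t where t: "\<And>i. 2 \<le> i \<Longrightarrow> i + 2 \<le> N \<Longrightarrow> c i (N - i) = f i + (-1) ^ i * t"
    using level[OF assms(1) f] by blast
  have "c m (N - m) = f m + (-1) ^ m * t"
    using i assms(2) by (intro t) auto
  then have "t = 0"
    using assms(2,3) by simp
  then show ?thesis
    using t[OF i] by simp
qed

text \<open>These are the coefficients after replacing e_i by s * e_i for all i \<ge> 2 while
  keeping e_1.\<close>

lemma scaled: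
  assumes "s \<noteq> 0"
  shows "filiform_coeffs n (\<lambda>i j. if i = 1 \<or> j = 1 then c i j else s * c i j)" (is "filiform_coeffs n ?d")
proof
  show "?d i j = - ?d j i" for i j
    using anti[of i j] by auto
  show "?d 1 i = 1" if "2 \<le> i" "i < n" for i
    using one that by auto
  fix i j k :: nat
  assume *: "1 \<le> i" "1 \<le> j" "1 \<le> k" "i + j + k \<le> n"
  \<comment> \<open>The Jacobi sum is homogeneous: the factor depends only on how many of i, j, k
    equal 1. If two of them do, the one term with another factor contains \<open>c 1 1\<close>,
    which is 0.\<close>
  have "?d j k * ?d i (j + k) + ?d k i * ?d j (k + i) + ?d i j * ?d k (i + j)
      = (if i = 1 \<and> j = 1 \<or> i = 1 \<and> k = 1 \<or> j = 1 \<and> k = 1 then 1 else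
         if i = 1 \<or> j = 1 \<or> k = 1 then s else s\<^sup>2) *
        (c j k * c i (j + k) + c k i * c j (k + i) + c i j * c k (i + j))"
    using * anti[of 1] by (auto simp: algebra_simps power2_eq_square)
  also have "\<dots> = 0"
    using jacobi[OF *] by simp
  finally show "?d j k * ?d i (j + k) + ?d k i * ?d j (k + i) + ?d i j * ?d k (i + j) = 0" .
qed


section \<open>The branch \<open>c 3 4 = 1\<close>: the families g up to level 11, and level
  12\<close>

text \<open>Up to level 8 the recursion alone suffices, the free parameters being
  \<open>c 2 3\<close> at level 5 and \<open>c 3 4\<close> at level 7. The shift by 2 in a matches
  the entry 2 + \<alpha> of \<open>g_coeff\<close>.\<close>

lemma g_coeff_8:
  assumes "c 3 4 = 1" and a: "a = c 2 3 - 2" and "1 \<le> i" "i < j" "i + j \<le> n" "i + j \<le> 8"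
  shows "c i j = g_coeff a i j"
proof -
  have r: "c 2 3 = c 2 4" if "6 \<le> n"
    using rec[of 2 3] that by simp
  have r7: "c 2 4 = c 3 4 + c 2 5" if "7 \<le> n"
    using rec[of 2 4] that by simp
  have r8: "c 3 4 = c 3 5" "c 2 5 = c 3 5 + c 2 6" if "8 \<le> n"
    using rec[of 3 4] rec[of 2 5] that by auto
  consider "i = 1" "2 \<le> j" "j < n" | "(i, j) = (2, 3)" | "(i, j) = (2, 4)" | "(i, j) = (2, 5)" | "(i, j) = (3, 4)"
    | "(i, j) = (2, 6)" | "(i, j) = (3, 5)"
  proof -
    have "j \<in> {2,3,4,5,6,7}" "i \<in> {1,2,3,4,5,6}" using assms by auto
    then show ?thesis using that assms by auto
  qed
  then show ?thesis
    using assms r r7 r8 one[of j] by cases (auto simp: g_coeff_def)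
qed

text \<open>The Jacobi identity of degree 9, rewritten in \<open>c 2 3\<close> and
  \<open>c 4 5\<close>. As 3 is nonzero, it also forbids \<open>2 * c 2 3 + 1 = 0\<close>, which is
  the exclusion of \<alpha> = -5/2.\<close>

lemma relation_9:
  assumes "9 \<le> n" "c 3 4 = 1"
  shows "(2 * c 2 3 + 1) * c 4 5 = 3"
proof -
  have r: "c 2 3 = c 2 4" "c 2 4 = c 3 4 + c 2 5" "c 3 4 = c 3 5" "c 2 5 = c 3 5 + c 2 6"
    "c 3 5 = c 4 5 + c 3 6" "c 2 6 = c 3 6 + c 2 7"
    using assms rec[of 2 3] rec[of 2 4] rec[of 3 4] rec[of 2 5] rec[of 3 5] rec[of 2 6] by auto
  have "c 3 4 * c 2 7 - c 2 4 * c 3 6 - c 2 3 * c 5 4 = 0"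
    using jacobi_23[of 9] assms by simp
  moreover have "c 5 4 = - c 4 5"
    by (rule anti)
  ultimately show ?thesis
    using r assms by algebra
qed

lemma g_coeff_10:
  assumes "9 \<le> n" "c 3 4 = 1" and a: "a = c 2 3 - 2" and "1 \<le> i" "i < j" "i + j \<le> n" "i + j \<le> 10"
  shows "2 * a + 5 \<noteq> 0" "c i j = g_coeff a i j"
proof -
  have z: "(2 * a + 5) * c 4 5 = 3"
  proof -
    have "2 * a + 5 = 2 * c 2 3 + 1"
      by (simp add: a)
    then show ?thesis
      using relation_9[OF assms(1,2)] by (simp only:)
  qed
  then show D: "2 * a + 5 \<noteq> 0"
    by (metis mult_zero_left zero_neq_numeral)
  have z': "c 4 5 = 3 / (2 * a + 5)"
    using nonzero_mult_div_cancel_left[OF D, of "c 4 5"] z by simp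
  have c8: "c 3 5 = 1" "c 2 6 = a"
    using assms g_coeff_8[of a 3 5] g_coeff_8[of a 2 6] by (auto simp: g_coeff_def)
  have r9: "c 3 6 = 1 - c 4 5" "c 2 7 = a - c 3 6"
  proof -
    have "c 3 5 = c 4 5 + c 3 6" "c 2 6 = c 3 6 + c 2 7"
      using assms(1) rec[of 3 5] rec[of 2 6] by auto
    then show "c 3 6 = 1 - c 4 5" "c 2 7 = a - c 3 6"
      using c8 by algebra+
  qed
  \<comment> \<open>Level 10 is even and brings no parameter: \<open>c 5 5 = 0\<close> makes
    \<open>c 4 6\<close> equal to \<open>c 4 5\<close>, and the rest follows by recursion.\<close>
  have r10: "c 4 6 = c 4 5" "c 3 7 = c 3 6 - c 4 6" "c 2 8 = c 2 7 - c 3 7" if "10 \<le> n"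
    using assms that rec[of 4 5] rec[of 3 6] rec[of 2 7] by auto
  have D36: "(2 * a + 5) * c 3 6 = 2 * a + 2"
  proof -
    have "(2 * a + 5) * c 3 6 = (2 * a + 5) - (2 * a + 5) * c 4 5"
      by (simp add: r9 algebra_simps)
    then show ?thesis
      by (simp only: z) simp
  qed
  moreover have D27: "(2 * a + 5) * c 2 7 = 2 * a^2 + 3 * a - 2"
    using D36 r9(2) by algebra
  ultimately have k9: "c 3 6 = (2 * a + 2) / (2 * a + 5)" "c 2 7 = (2 * a^2 + 3 * a - 2) / (2 * a + 5)"
    using D by (simp_all add: nonzero_eq_divide_eq mult.commute)
  have "(2 * a + 5) * c 3 7 = 2 * a - 1" "(2 * a + 5) * c 2 8 = 2 * a^2 + a - 1" if "10 \<le> n"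
  proof -
    define d where "d = 2 * a + 5"
    have "d * c 4 5 = 3" "d * c 3 6 = 2 * a + 2" "d * c 2 7 = 2 * a^2 + 3 * a - 2"
      using z D36 D27 by (simp_all only: d_def)
    then have "d * c 3 7 = 2 * a + 2 - 3" and 28: "d * c 2 8 = 2 * a^2 + 3 * a - 2 - d * c 3 7"
      using r10[OF that] by (simp_all only: right_diff_distrib)
    then have "d * c 3 7 = 2 * a - 1" "d * c 2 8 = 2 * a^2 + a - 1"
      by (simp_all add: 28)
    then show "(2 * a + 5) * c 3 7 = 2 * a - 1" "(2 * a + 5) * c 2 8 = 2 * a^2 + a - 1"
      by (simp_all only: d_def)
  qed
  note D37 = this
  have k10: "c 4 6 = 3 / (2 * a + 5)" "c 3 7 = (2 * a - 1) / (2 * a + 5)"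
    "c 2 8 = (2 * a^2 + a - 1) / (2 * a + 5)" if "10 \<le> n"
    subgoal
      using r10(1)[OF that] z' by simp
    subgoal
      by (rule eq_divide_imp[OF D], subst mult.commute, rule D37[OF that])
    subgoal
      by (rule eq_divide_imp[OF D], subst mult.commute, rule D37[OF that])
    done
  consider "i + j \<le> 8" | "i = 1" "2 \<le> j" "j < n" | "(i, j) = (2, 7)" | "(i, j) = (3, 6)" | "(i, j) = (4, 5)"
    | "10 \<le> n" "(i, j) = (2, 8)" | "10 \<le> n" "(i, j) = (3, 7)" | "10 \<le> n" "(i, j) = (4, 6)"
  proof -
    have "j \<in> {2,3,4,5,6,7,8,9}" "i \<in> {1,2,3,4,5,6,7,8}" using assms by auto
    then show ?thesis using that assms by auto
  qed
  then show "c i j = g_coeff a i j"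
  proof cases
    case 1
    then show ?thesis using g_coeff_8 assms by blast
  next
    case 2
    then show ?thesis using one[of j] by (simp add: g_coeff_def)
  qed (use k9 k10 z' in \<open>auto simp: g_coeff_def\<close>)
qed

text \<open>The Jacobi identity of degree 11 is linear in the free parameter \<open>c 5 6\<close>.
  Its leading factor cannot vanish, which excludes \<alpha> = -1 and \<alpha> = -3, the roots of the
  quadratic.\<close>

lemma relation_11:
  assumes "11 \<le> n" "c 3 4 = 1" and a: "a = c 2 3 - 2"
  shows "2 * (a\<^sup>2 + 4 * a + 3) * (2 * a + 5) * c 5 6 = 3 * (4 * a + 1)"
    and "a\<^sup>2 + 4 * a + 3 \<noteq> 0"
    and "c 4 7 = c 4 6 - c 5 6" "c 3 8 = c 3 7 - c 4 7" "c 2 9 = c 2 8 - c 3 8"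
proof -
  have D: "2 * a + 5 \<noteq> 0"
    using g_coeff_10(1)[of a 1 2] assms by simp
  have e: "c 3 6 = (2 * a + 2) / (2 * a + 5)" "c 2 6 = a" "c 4 6 = 3 / (2 * a + 5)"
    "c 3 7 = (2 * a - 1) / (2 * a + 5)" "c 2 8 = (2 * a^2 + a - 1) / (2 * a + 5)"
    using assms g_coeff_10(2)[of a 3 6] g_coeff_10(2)[of a 2 6] g_coeff_10(2)[of a 4 6]
      g_coeff_10(2)[of a 3 7] g_coeff_10(2)[of a 2 8]
    by (auto simp: g_coeff_def)
  show r: "c 4 7 = c 4 6 - c 5 6" "c 3 8 = c 3 7 - c 4 7" "c 2 9 = c 2 8 - c 3 8"
    using assms rec[of 4 6] rec[of 3 7] rec[of 2 8] by auto
  have J: "c 3 6 * c 2 9 - c 2 6 * c 3 8 - c 2 3 * c 5 6 = 0"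
    using jacobi_23[of 11] assms by simp
  define w where "w = c 5 6"
  define D where "D = 2 * a + 5"
  have D0: "D \<noteq> 0" using D by (simp add: D_def)
  \<comment> \<open>Denominators are cleared by multiplying with the square of D; one factor D too
    many remains and is cancelled below.\<close>
  have J': "c 3 6 * D * (c 2 9 * D) - a * (c 3 8 * D) * D - c 2 3 * w * D * D = 0"
    using J e(2) w_def by algebra
  have m: "c 3 6 * D = 2 * a + 2" "c 4 6 * D = 3" "c 3 7 * D = 2 * a - 1" "c 2 8 * D = 2 * a^2 + a - 1"
    by (simp_all add: e(1,3-5)[folded D_def] D0)
  have m': "c 3 8 * D = 2 * a - 4 + w * D" "c 2 9 * D = 2 * a^2 - a + 3 - w * D"
    using r m w_def by algebra+
  have "D * (2 * (a\<^sup>2 + 4 * a + 3) * D * w - 3 * (4 * a + 1)) = 0"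
    using J' m m' a D_def by algebra
  then show *: "2 * (a\<^sup>2 + 4 * a + 3) * (2 * a + 5) * c 5 6 = 3 * (4 * a + 1)"
    using D0 by (simp add: D_def w_def)
  show "a\<^sup>2 + 4 * a + 3 \<noteq> 0"
  proof
    assume E: "a\<^sup>2 + 4 * a + 3 = 0"
    \<comment> \<open>At the roots -1 and -3 the right-hand side 3 * (4 * a + 1) takes the values -9
      and -33, whose product is 297.\<close>
    then have "(297 :: 'k) = 0"
      using * by algebra
    then show False by simp
  qed
qed

lemma g_coeff_11:
  assumes "11 \<le> n" "c 3 4 = 1" and a: "a = c 2 3 - 2" and "1 \<le> i" "i < j" "i + j \<le> n" "i + j \<le> 11"
  shows "c i j = g_coeff a i j"
proof -
  define D where "D = 2 * a + 5"
  define E where "E = a\<^sup>2 + 4 * a + 3"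
  have D0: "D \<noteq> 0"
    using g_coeff_10(1)[of a 1 2] assms by (simp add: D_def)
  have E0: "E \<noteq> 0"
    using relation_11 assms unfolding E_def by blast
  have w: "2 * E * D * c 5 6 = 3 * (4 * a + 1)"
    using relation_11 assms unfolding D_def E_def by blast
  have e: "c 4 6 = 3 / D" "c 3 7 = (2 * a - 1) / D" "c 2 8 = (2 * a^2 + a - 1) / D"
    using assms g_coeff_10(2)[of a 4 6] g_coeff_10(2)[of a 3 7] g_coeff_10(2)[of a 2 8]
    by (auto simp: g_coeff_def D_def)
  have m: "c 4 6 * D = 3" "c 3 7 * D = 2 * a - 1" "c 2 8 * D = 2 * a^2 + a - 1"
    using e D0 by auto
  have r: "c 4 7 = c 4 6 - c 5 6" "c 3 8 = c 3 7 - c 4 7" "c 2 9 = c 2 8 - c 3 8"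
    using relation_11 assms by blast+
  have k: "c 5 6 = 3 * (4 * a + 1) / (2 * E * D)"
    using w D0 E0 by (simp add: nonzero_eq_divide_eq mult.commute)
  have "2 * E * D * c 4 7 = 3 * (2 * a^2 + 4 * a + 5)"
    using w r m E_def by algebra
  then have k2: "c 4 7 = 3 * (2 * a^2 + 4 * a + 5) / (2 * E * D)"
    using D0 E0 by (simp add: nonzero_eq_divide_eq mult.commute)
  have k3': "2 * E * D * c 3 8 = 4 * a^3 + 8 * a^2 - 8 * a - 21"
    using w r m E_def by algebra
  then have k3: "c 3 8 = (4 * a^3 + 8 * a^2 - 8 * a - 21) / (2 * E * D)"
    using D0 E0 by (simp add: nonzero_eq_divide_eq mult.commute)
  \<comment> \<open>The numerator of \<open>c 2 9\<close> is divisible by D, so its tabulated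
    denominator lacks the factor 2 * \<alpha> + 5.\<close>
  have "D * (2 * E * c 2 9) = D * (2 * a^3 + 2 * a^2 + 3)"
    using k3' r m E_def D_def by algebra
  then have "2 * E * c 2 9 = 2 * a^3 + 2 * a^2 + 3"
    using mult_left_cancel[OF D0] by blast
  then have k4: "c 2 9 = (2 * a^3 + 2 * a^2 + 3) / (2 * E)"
    using D0 E0 by (simp add: nonzero_eq_divide_eq mult.commute)
  consider "i + j \<le> 10" | "i = 1" "2 \<le> j" "j < n" | "(i, j) = (2, 9)" | "(i, j) = (3, 8)" | "(i, j) = (4, 7)"
    | "(i, j) = (5, 6)"
  proof -
    have "j \<in> {2,3,4,5,6,7,8,9,10}" "i \<in> {1,2,3,4,5,6,7,8,9}" using assms by auto
    then show ?thesis using that assms by auto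
  qed
  then show "c i j = g_coeff a i j"
  proof cases
    case 1
    then show ?thesis using g_coeff_10(2)[of a i j] assms by linarith
  next
    case 2
    then show ?thesis using one[of j] by (simp add: g_coeff_def)
  qed (auto simp: g_coeff_def k k2 k3 k4 D_def E_def)
qed

text \<open>Level 12 has no free parameter, so its Jacobi identity is a condition on a alone. After
  clearing denominators it becomes 18 * D * (a - 8) = 0, and a = 8 is the Witt algebra.\<close>

lemma relation_12:
  assumes "12 \<le> n" "c 3 4 = 1"
  shows "c 2 3 = 10"
proof -
  define a where "a = c 2 3 - 2"
  define D where "D = 2 * a + 5"
  define E where "E = a\<^sup>2 + 4 * a + 3"
  define w where "w = c 5 6"
  have D0: "D \<noteq> 0"
    using g_coeff_10(1)[of a 1 2] assms by (simp add: D_def a_def)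
  have w: "2 * E * D * w = 3 * (4 * a + 1)"
    using relation_11[of a] assms unfolding D_def E_def a_def w_def by auto
  have e: "c 3 7 = (2 * a - 1) / D" "c 2 7 = (2 * a^2 + 3 * a - 2) / D" "c 4 6 = 3 / D" "c 2 8 = (2 * a^2 + a - 1) / D"
    using assms g_coeff_10(2)[of a 3 7] g_coeff_10(2)[of a 2 7] g_coeff_10(2)[of a 4 6] g_coeff_10(2)[of a 2 8]
    by (auto simp: g_coeff_def D_def a_def)
  have m: "c 3 7 * D = 2 * a - 1" "c 2 7 * D = 2 * a^2 + 3 * a - 2" "c 4 6 * D = 3"
    "c 2 8 * D = 2 * a^2 + a - 1"
    using e D0 by auto
  have r: "c 4 7 = c 4 6 - w" "c 3 8 = c 3 7 - c 4 7" "c 2 9 = c 2 8 - c 3 8"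
    using relation_11[of a] assms unfolding w_def a_def by auto
  have r12: "c 5 7 = w" "c 4 8 = c 4 7 - w" "c 3 9 = c 3 8 - c 4 8" "c 2 10 = c 2 9 - c 3 9"
    using assms rec[of 5 6] rec[of 4 7] rec[of 3 8] rec[of 2 9] by (auto simp: w_def)
  have J: "c 3 7 * c 2 10 - c 2 7 * c 3 9 - c 2 3 * w = 0"
    using jacobi_23[of 12] assms r12 by simp
  have m': "D * c 3 9 = 2 * a - 7 + 3 * (D * w)" "D * c 2 10 = 2 * a^2 - 3 * a + 10 - 4 * (D * w)"
    using r r12 m by algebra+
  have "(D * c 3 7) * (D * c 2 10) - (D * c 2 7) * (D * c 3 9) - D * (a + 2) * (D * w) = 0"
    using J a_def by algebra
  then have "(2 * a - 1) * (2 * a^2 - 3 * a + 10 - 4 * (D * w)) - (2 * a^2 + 3 * a - 2) * (2 * a - 7 + 3 * (D * w)) - D * (a + 2) * (D * w) = 0"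
    using m m' by (simp add: mult.commute)
  then have "18 * D * (a - 8) = 0"
    using w D_def E_def by algebra
  then have "a = 8"
    using D0 by simp
  then show ?thesis
    by (simp add: a_def algebra_simps)
qed

end

section \<open>The Witt algebra in the normalised basis\<close>

text \<open>
  The coefficients \<open>j - i\<close> with respect to the basis \<open>e\<^sub>1, 60 \<cdot> (i - 2)! \<cdot> e\<^sub>i\<close> (\<open>i \<ge> 2\<close>), in which
  \<open>[e\<^sub>1, e\<^sub>i] = e\<^bsub>i+1\<^esub>\<close> and \<open>[e\<^sub>3, e\<^sub>4] = e\<^sub>7\<close>.
\<close>

definition Witt_coeff :: "nat \<Rightarrow> nat \<Rightarrow> 'k::field_char_0" where
  "Witt_coeff i j = 60 * fact (i - 2) * fact (j - 2) * (of_nat j - of_nat i) / fact (i + j - 2)"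

text \<open>Positivity over the rationals yields that sums of these coefficients do not vanish in characteristic 0.\<close>

lemma Witt_coeff_of_rat: "Witt_coeff i j = of_rat (Witt_coeff i j)"
proof -
  have [simp]: "of_rat (fact m) = (fact m :: 'a)" for m
    by (metis of_nat_fact of_rat_of_nat_eq)
  show ?thesis
    by (simp add: Witt_coeff_def of_rat_divide of_rat_mult of_rat_diff)
qed

lemma Witt_coeff_pos: "i < j \<Longrightarrow> (Witt_coeff i j :: 'a::linordered_field) > 0"
  by (simp add: Witt_coeff_def)

text \<open>With p = i - 2 and q = j - 2, cancelling the factorials leaves (p + q + 3)(q - p) = (p +
  1)(q - p - 1) + (q + 1)(q + 1 - p).\<close>

lemma Witt_coeff_rec:
  assumes "2 \<le> i" "2 \<le> j"
  shows "Witt_coeff i j = Witt_coeff (i + 1) j + Witt_coeff i (j + 1)"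
proof -
  obtain p q where p: "i = p + 2" and q: "j = q + 2"
    using assms by (metis add.commute le_Suc_ex)
  have "of_nat (p + q + 3) * (of_nat q - of_nat p :: 'a)
      = of_nat (p + 1) * (of_nat q - of_nat p - 1) + of_nat (q + 1) * (of_nat q + 1 - of_nat p)"
    by (simp add: algebra_simps)
  moreover have "of_nat (p + q + 3) \<noteq> (0 :: 'a)"
    by (simp only: of_nat_eq_0_iff)
  ultimately have *: "(of_nat q - of_nat p :: 'a)
      = (of_nat (p + 1) * (of_nat q - of_nat p - 1) + of_nat (q + 1) * (of_nat q + 1 - of_nat p))
        / of_nat (p + q + 3)"
    by (simp add: nonzero_eq_divide_eq mult.commute)
  have f: "fact (p + 1) = of_nat (p + 1) * (fact p :: 'a)" "fact (q + 1) = of_nat (q + 1) * (fact q :: 'a)"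
    "fact (p + q + 3) = of_nat (p + q + 3) * (fact (p + q + 2) :: 'a)"
    using fact_Suc[of p, where 'a = 'a] fact_Suc[of q, where 'a = 'a]
      fact_Suc[of "p + q + 2", where 'a = 'a]
    by (simp_all add: eval_nat_numeral del: fact_Suc of_nat_Suc)
  have 1: "Witt_coeff i j = 60 * fact p * fact q * (of_nat q - of_nat p :: 'a) / fact (p + q + 2)"
    by (simp add: Witt_coeff_def p q)
  have 2: "Witt_coeff (i + 1) j = 60 * fact (p + 1) * fact q * (of_nat q - of_nat p - 1 :: 'a) / fact (p + q + 3)"
    "Witt_coeff i (j + 1) = 60 * fact p * fact (q + 1) * (of_nat q + 1 - of_nat p :: 'a) / fact (p + q + 3)"
    by (simp_all add: Witt_coeff_def p q eval_nat_numeral del: fact_Suc)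
  have "60 * P * Q * ((a * x + b * y) / s) / F = 60 * (a * P) * Q * x / (s * F) + 60 * P * (b * Q) * y / (s * F)"
    for P Q F a b x y s :: 'a
    by (simp add: add_divide_distrib algebra_simps)
  then show ?thesis
    unfolding 1 2 f by (subst *)
qed

text \<open>The common factor 3600 * p! / (p + 5)! with p = j - 2 reduces the claim to (p - 1)(p +
  3) - p(p + 1) - (p - 3) = 0.\<close>

lemma Witt_coeff_jacobi_23:
  assumes "4 \<le> j"
  shows "Witt_coeff 3 j * Witt_coeff 2 (j + 3) - Witt_coeff 2 j * Witt_coeff 3 (j + 2)
    - Witt_coeff 2 3 * Witt_coeff 5 j = (0 :: 'k::field_char_0)"
proof -
  obtain p where p: "j = p + 2"
    using assms le_Suc_ex[of 2 j] by (auto simp: add.commute)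
  define F2 F3 F5 :: 'k where "F2 = fact (p + 2)" and "F3 = fact (p + 3)" and "F5 = fact (p + 5)"
  have nz: "F2 \<noteq> 0" "F3 \<noteq> 0" "F5 \<noteq> 0"
    by (simp_all only: F2_def F3_def F5_def fact_nonzero not_False_eq_True)
  have w: "Witt_coeff 3 j = 60 * fact p * (of_nat p - 1) / F3"
    "Witt_coeff 2 (j + 3) = 60 * F3 * (of_nat p + 3) / F5"
    "Witt_coeff 2 j = 60 * fact p * of_nat p / F2"
    "Witt_coeff 3 (j + 2) = 60 * F2 * (of_nat p + 1) / F5"
    "Witt_coeff 5 j = 360 * fact p * (of_nat p - 3) / F5"
    "Witt_coeff 2 3 = (10 :: 'k)"
    by (simp_all add: Witt_coeff_def p F2_def F3_def F5_def fact_numeral add.commute del: fact_Suc)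
  have "Witt_coeff 3 j * Witt_coeff 2 (j + 3) = 3600 * fact p * ((of_nat p - 1) * (of_nat p + 3)) / F5"
    "Witt_coeff 2 j * Witt_coeff 3 (j + 2) = 3600 * fact p * (of_nat p * (of_nat p + 1)) / F5"
    "Witt_coeff 2 3 * Witt_coeff 5 j = 3600 * fact p * (of_nat p - 3) / F5"
    unfolding w using nz by simp_all
  moreover have "3600 * fact p * ((of_nat p - 1) * (of_nat p + 3)) - 3600 * fact p * (of_nat p * (of_nat p + 1))
      - 3600 * fact p * (of_nat p - 3) = (0 :: 'k)"
    by (simp add: algebra_simps)
  ultimately show ?thesis
    by (simp only: diff_divide_distrib[symmetric]) simp
qed

context filiform_coeffs begin

text \<open>Induction on the level i + j. At odd levels the parameter t is killed by
  \<open>relation_12\<close> for N = 5, by the normalisation for N = 7, and by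
  \<open>jacobi_23\<close> from 9 on.\<close>

lemma Witt:
  assumes "12 \<le> n" "c 3 4 = 1" "2 \<le> i" "2 \<le> j" "i + j \<le> n"
  shows "c i j = Witt_coeff i j"
proof -
  have "\<forall>i. 2 \<le> i \<longrightarrow> i + 2 \<le> N \<longrightarrow> c i (N - i) = Witt_coeff i (N - i)" if "N \<le> n" for N
    using that
  proof (induction N rule: less_induct)
    case (less N)
    let ?f = "\<lambda>i. Witt_coeff i (N - i)"
    have f: "c i (N - 1 - i) = ?f (i + 1) + ?f i" if "2 \<le> i" "i + 3 \<le> N" for i
    proof -
      have "c i (N - 1 - i) = Witt_coeff i (N - 1 - i)"
        using less.IH[of "N - 1"] less.prems that by simp
      also have "\<dots> = Witt_coeff (i + 1) (N - 1 - i) + Witt_coeff i (N - 1 - i + 1)"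
        using that by (intro Witt_coeff_rec) auto
      finally show ?thesis
        using that by (simp add: Suc_diff_Suc)
    qed
    show ?case
    proof (cases "even N")
      case True
      then obtain m where m: "N = 2 * m" by blast
      show ?thesis
        using level_even[OF less.prems m _ f] m by (auto simp: Witt_coeff_def)
    next
      case False
      obtain t where t: "c i (N - i) = ?f i + (-1) ^ i * t" if "2 \<le> i" "i + 2 \<le> N" for i
        using level[OF less.prems f] by blast
      have "t = 0" if "5 \<le> N"
      proof -
        have "N = 5 \<or> N = 7 \<or> 9 \<le> N"
          using that False by presburger
        then consider "N = 5" | "N = 7" | "9 \<le> N"
          by blast
        then show ?thesis
        proof cases
          case 1
          have "c 2 3 = (10 :: 'k)"
            using relation_12 assms by blast
          then show ?thesis
            using t[of 2] 1 by (simp add: Witt_coeff_def fact_numeral)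
        next
          case 2
          then show ?thesis
            using t[of 3] assms by (simp add: Witt_coeff_def fact_numeral)
        next
          case 3
          have s: "N - 5 + 3 = N - 2" "N - 5 + 2 = N - 3"
            using 3 by auto
          have low: "c 3 (N - 5) = Witt_coeff 3 (N - 5)" "c 2 (N - 5) = Witt_coeff 2 (N - 5)"
            "c 2 3 = Witt_coeff 2 3"
            using 3 less.IH[of "N - 2", rule_format, of 3] less.IH[of "N - 3", rule_format, of 2]
              less.IH[of 5, rule_format, of 2] less.prems
            by (auto simp: numeral_eq_Suc)
          have top: "c 2 (N - 2) = Witt_coeff 2 (N - 2) + t" "c 3 (N - 3) = Witt_coeff 3 (N - 3) - t"
            "c 5 (N - 5) = Witt_coeff 5 (N - 5) - t"
            using t[of 2] t[of 3] t[of 5] 3 by auto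
          have "c 3 (N - 5) * c 2 (N - 2) - c 2 (N - 5) * c 3 (N - 3) - c 2 3 * c 5 (N - 5) = 0"
            using less.prems 3 by (intro jacobi_23) auto
          \<comment> \<open>Subtracting the same identity for the Witt coefficients leaves only the
            terms linear in t, all with the same sign.\<close>
          then have "(Witt_coeff 3 (N - 5) + Witt_coeff 2 (N - 5) + Witt_coeff 2 3) * t = (0 :: 'k)"
            using Witt_coeff_jacobi_23[of "N - 5", where 'k = 'k] 3
            unfolding low top s by (simp add: algebra_simps)
          moreover have "Witt_coeff 3 (N - 5) + Witt_coeff 2 (N - 5) + Witt_coeff 2 3 > (0 :: rat)"
            using 3 by (intro add_pos_pos Witt_coeff_pos) auto
          then have "Witt_coeff 3 (N - 5) + Witt_coeff 2 (N - 5) + Witt_coeff 2 3 \<noteq> (0 :: 'k)"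
            by (subst (1 2 3) Witt_coeff_of_rat) (simp flip: of_rat_add)
          ultimately show ?thesis
            by simp
        qed
      qed
      moreover have "5 \<le> N" if "2 \<le> i" "i + 2 \<le> N" for i
        using that False by (cases "N = 4") auto
      ultimately show ?thesis
        using t by auto
    qed
  qed
  then show ?thesis
    using assms(3-5) by (metis add_diff_cancel_left' nat_add_left_cancel_le)
qed

section \<open>The branch of \<open>m2\<close>\<close>

lemma m2_coeff:
  assumes "c 2 3 = 1" "7 \<le> n \<Longrightarrow> c 3 4 = 0" and ij: "2 \<le> i" "i < j" "i + j \<le> n"
  shows "c i j = (if i = 2 then 1 else 0)"
proof -
  \<comment> \<open>A whole level is described, including i > N - i; the final -1 is the
    antisymmetric partner of \<open>c 2 (N - 2) = 1\<close>.\<close>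
  let ?f = "\<lambda>N i. if i = 2 then 1 else if i + 2 = N then - 1 else 0"
  have "\<forall>i. 2 \<le> i \<longrightarrow> i + 2 \<le> N \<longrightarrow> c i (N - i) = ?f N i" if "5 \<le> N" "N \<le> n" for N
    using that
  proof (induction N rule: less_induct)
    case (less N)
    show ?case
    proof (cases "N = 5")
      case True
      show ?thesis
      proof (intro allI impI)
        fix i assume "2 \<le> i" "i + 2 \<le> N"
        then consider "i = 2" | "i = 3" using True by linarith
        then show "c i (N - i) = ?f N i"
          using True assms(1) anti[of 3 2] by cases simp_all
      qed
    next
      case False
      have f: "c i (N - 1 - i) = ?f N (i + 1) + ?f N i" if "2 \<le> i" "i + 3 \<le> N" for i
        using less.IH[of "N - 1", rule_format, of i] less.prems that False by auto
      show ?thesis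
      proof (cases "even N")
        case True
        then obtain m where m: "N = 2 * m" by blast
        show ?thesis
          using level_even[OF less.prems(2) m _ f] m less.prems by simp
      next
        case False': False
        obtain t where t: "c i (N - i) = ?f N i + (-1) ^ i * t" if "2 \<le> i" "i + 2 \<le> N" for i
          using level[OF less.prems(2), of "?f N", OF f] by blast
        have "t = 0"
        proof (cases "N = 7")
          case True
          then show ?thesis
            using t[of 3] assms(2) less.prems by simp
        next
          case False'': False
          then have N: "9 \<le> N"
            using less.prems False False' by (cases "N = 6 \<or> N = 8") auto
          have low: "c 3 (N - 5) = 0" "c 2 (N - 5) = 1"
            using N less.IH[of "N - 2", rule_format, of 3] less.IH[of "N - 3", rule_format, of 2] less.prems
            by (auto simp: numeral_eq_Suc)
          have top: "c 3 (N - 3) = - t" "c 5 (N - 5) = - t"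
            using t[of 3] t[of 5] N by auto
          have "c 3 (N - 5) * c 2 (N - 2) - c 2 (N - 5) * c 3 (N - 3) - c 2 3 * c 5 (N - 5) = 0"
            using less.prems N by (intro jacobi_23) auto
          \<comment> \<open>The identity has become 2 * t = 0.\<close>
          then show ?thesis
            unfolding low top assms(1) by (simp flip: mult_2)
        qed
        then show ?thesis
          using t by simp
      qed
    qed
  qed
  from this[of "i + j"] show ?thesis
    using ij by auto
qed

section \<open>The lowest nonzero level and the algebras \<open>m01\<close>, \<open>m02\<close>,
  \<open>m03\<close>\<close>

text \<open>The level below is zero, so the recursion makes level M alternate in sign. For even M
  the middle coefficient would make all of it vanish.\<close>

lemma lowest_level_odd:
  assumes M: "M \<le> n" and low: "\<And>i j. 2 \<le> i \<Longrightarrow> 2 \<le> j \<Longrightarrow> i + j < M \<Longrightarrow> c i j = 0"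
    and nz: "2 \<le> i" "2 \<le> j" "i + j = M" "c i j \<noteq> 0"
  shows "odd M" "\<And>i. 2 \<le> i \<Longrightarrow> i + 2 \<le> M \<Longrightarrow> c i (M - i) = (-1) ^ i * c 2 (M - 2)"
proof -
  have f: "c i (M - 1 - i) = 0 + 0" if "2 \<le> i" "i + 3 \<le> M" for i
    using low[of i "M - 1 - i"] that by simp
  show "odd M"
  proof
    assume "even M"
    then obtain m where m: "M = 2 * m" by blast
    have "c i (M - i) = 0"
      using level_even[of M m "\<lambda>_. 0", OF M m _ f] nz by auto
    then show False
      using nz by auto
  qed
  obtain t where t: "c i (M - i) = 0 + (-1) ^ i * t" if "2 \<le> i" "i + 2 \<le> M" for i
    using level[of M "\<lambda>_. 0", OF M f] by blast
  show "c i (M - i) = (-1) ^ i * c 2 (M - 2)" if "2 \<le> i" "i + 2 \<le> M" for i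
    using t[OF that] t[of 2] that by simp
qed

text \<open>Level 2k + 2 follows from level 2k + 1, the parameter of level 2k + 3 is fixed by a
  Jacobi identity, and level 2k + 4 is contradictory for k \<ge> 4. The value -1 agrees with the
  sign of \<open>m01\<close> at index 2.\<close>

lemma m0_levels:
  assumes k: "4 \<le> k" "2 * k + 1 \<le> n"
    and low: "\<And>i j. 2 \<le> i \<Longrightarrow> 2 \<le> j \<Longrightarrow> i + j < 2 * k + 1 \<Longrightarrow> c i j = 0"
    and top: "c 2 (2 * k - 1) = - 1"
  shows "\<And>i. 2 \<le> i \<Longrightarrow> i < 2 * k \<Longrightarrow> c i (2 * k + 1 - i) = (-1) ^ (i + 1)"
    and "\<And>i. 2 * k + 2 \<le> n \<Longrightarrow> 2 \<le> i \<Longrightarrow> i \<le> 2 * k \<Longrightarrow>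
      c i (2 * k + 2 - i) = (-1) ^ (i + 1) * (of_nat k - of_nat i + 1)"
    and "\<And>i. 2 * k + 3 \<le> n \<Longrightarrow> 2 \<le> i \<Longrightarrow> i \<le> 2 * k + 1 \<Longrightarrow> c i (2 * k + 3 - i) =
      (-1) ^ i * ((of_nat i - 2) * of_nat k - (of_nat i - 2) * (of_nat i - 1) / 2)"
    and "n \<le> 2 * k + 3"
proof -
  have s: "2 * k + 1 - 2 = 2 * k - 1"
    by simp
  have "c i (2 * k + 1 - i) = (-1) ^ i * c 2 (2 * k + 1 - 2)" if "2 \<le> i" "i < 2 * k" for i
    using k low top that lowest_level_odd(2)[of "2 * k + 1" 2 "2 * k - 1" i] by auto
  then show L1: "c i (2 * k + 1 - i) = (-1) ^ (i + 1)" if "2 \<le> i" "i < 2 * k" for i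
    using that top unfolding s by simp
  show L2: "c i (2 * k + 2 - i) = (-1) ^ (i + 1) * (of_nat k - of_nat i + 1)"
    if "2 * k + 2 \<le> n" "2 \<le> i" "i \<le> 2 * k" for i
  proof (rule level_even[of "2 * k + 2" "k + 1"])
    fix i assume "2 \<le> i" "i + 3 \<le> 2 * k + 2"
    then show "c i (2 * k + 2 - 1 - i) = (-1) ^ (i + 1 + 1) * (of_nat k - of_nat (i + 1) + 1)
      + (-1) ^ (i + 1) * (of_nat k - of_nat i + 1)"
      using L1[of i] by (simp add: algebra_simps)
  qed (use that in auto)
  show L3: "c i (2 * k + 3 - i) =
      (-1) ^ i * ((of_nat i - 2) * of_nat k - (of_nat i - 2) * (of_nat i - 1) / 2)"
    if n: "2 * k + 3 \<le> n" and i: "2 \<le> i" "i \<le> 2 * k + 1" for i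
  proof -
    let ?f = "\<lambda>i. (-1) ^ i * ((of_nat i - 2) * of_nat k - (of_nat i - 2) * (of_nat i - 1) / 2) :: 'k"
    have f: "c i (2 * k + 3 - 1 - i) = ?f (i + 1) + ?f i" if "2 \<le> i" "i + 3 \<le> 2 * k + 3" for i
    proof -
      have "(of_nat i - 2) * of_nat k - (of_nat i - 2) * (of_nat i - 1) / 2
          - ((of_nat i - 1) * of_nat k - (of_nat i - 1) * of_nat i / 2) = (of_nat i - of_nat k - 1 :: 'k)"
        by (simp add: field_simps)
      then have "?f i + ?f (i + 1) = (-1) ^ i * (of_nat i - of_nat k - 1)"
        by (simp flip: right_diff_distrib)
      moreover have "c i (2 * k + 3 - 1 - i) = (-1) ^ i * (of_nat i - of_nat k - 1)"
        using L2[of i] n that by (simp add: algebra_simps)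
      ultimately show ?thesis
        by (simp only: add.commute)
    qed
    obtain t where t: "c i (2 * k + 3 - i) = ?f i + (-1) ^ i * t" if "2 \<le> i" "i + 2 \<le> 2 * k + 3" for i
      using level[OF n f] by blast
    \<comment> \<open>With these values the Jacobi identity of degree 2k + 3 reduces to
      \<open>c 2 (2 * k + 1) = 0\<close>.\<close>
    have "c 3 (2 * k - 2) = 1" "c 2 (2 * k - 2) = 0" "c 2 3 = 0"
      using L1[of 3] low[of 2 "2 * k - 2"] low[of 2 3] k by (auto simp: numeral_eq_Suc)
    moreover have "c 3 (2 * k + 3 - 5) * c 2 (2 * k + 3 - 2) - c 2 (2 * k + 3 - 5) * c 3 (2 * k + 3 - 3)
        - c 2 3 * c 5 (2 * k + 3 - 5) = 0"
      using k n by (intro jacobi_23) auto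
    moreover have "2 * k + 3 - 5 = 2 * k - 2"
      by simp
    ultimately have "c 2 (2 * k + 3 - 2) = 0"
      by (metis diff_zero mult_1 mult_zero_left)
    then have "t = 0"
      using t[of 2] k by simp
    then show ?thesis
      using t i by simp
  qed
  show "n \<le> 2 * k + 3"
  proof (rule ccontr)
    assume "\<not> n \<le> 2 * k + 3"
    then have n: "2 * k + 4 \<le> n" by simp
    \<comment> \<open>T is an antidifference of the unsigned entries of level 2k + 3; in
      \<open>L4\<close> the constant T k makes the middle entry i = k + 2 vanish.\<close>
    define T :: "'k \<Rightarrow> 'k" where "T p = of_nat k * p * (p - 1) / 2 - (p - 1) * p * (p + 1) / 6" for p
    have L4: "c i (2 * k + 4 - i) = (-1) ^ i * (T (of_nat k) - T (of_nat i - 2))"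
      if i: "2 \<le> i" "i + 2 \<le> 2 * k + 4" for i
    proof (rule level_even[of "2 * k + 4" "k + 2"])
      fix i assume i: "2 \<le> i" "i + 3 \<le> 2 * k + 4"
      have "T (of_nat i - 1) - T (of_nat i - 2) = (of_nat i - 2) * of_nat k - (of_nat i - 2) * (of_nat i - 1) / 2"
        by (simp add: T_def field_simps)
      then have "c i (2 * k + 3 - i) = (-1) ^ i * (T (of_nat i - 1) - T (of_nat i - 2))"
        using L3[of i] n i by simp
      then show "c i (2 * k + 4 - 1 - i) = (-1) ^ (i + 1) * (T (of_nat k) - T (of_nat (i + 1) - 2))
          + (-1) ^ i * (T (of_nat k) - T (of_nat i - 2))"
        by (simp add: algebra_simps)
    qed (use n i in auto)
    have "c 3 (2 * k - 1) = of_nat k - 2" "c 2 3 = 0"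
      using L2[of 3] low[of 2 3] k n by (auto simp: numeral_eq_Suc)
    moreover have "c 2 (2 * k + 2) = T (of_nat k)" "c 3 (2 * k + 1) = - T (of_nat k)"
      using L4[of 2] L4[of 3] k by (auto simp: T_def)
    moreover have "c 3 (2 * k + 4 - 5) * c 2 (2 * k + 4 - 2) - c 2 (2 * k + 4 - 5) * c 3 (2 * k + 4 - 3)
        - c 2 3 * c 5 (2 * k + 4 - 5) = 0"
      using k n by (intro jacobi_23) auto
    moreover have "2 * k + 4 - 5 = 2 * k - 1" "2 * k + 4 - 2 = 2 * k + 2" "2 * k + 4 - 3 = 2 * k + 1"
      by simp_all
    \<comment> \<open>This amounts to (k - 3) * T k = 0 with 6 * T k = k(k - 1)(2k - 1). Only k = 3
      could survive, and that case belongs to the branch \<open>c 3 4 \<noteq> 0\<close>.\<close>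
    ultimately have "(of_nat k - 2) * T (of_nat k) - (- 1) * (- T (of_nat k)) = 0"
      using top by simp
    then have "(of_nat k - 3) * T (of_nat k) = 0"
      by (simp only: algebra_simps) simp
    moreover have "6 * T (of_nat k) = of_nat k * (of_nat k - 1) * (2 * of_nat k - 1)"
      by (simp add: T_def field_simps)
    ultimately have "of_nat k * (of_nat k - 1) * (2 * of_nat k - 1) * (of_nat k - 3) = (0 :: 'k)"
      by algebra
    moreover have "of_nat k * (of_nat k - 1) * (2 * of_nat k - 1) * (of_nat k - 3)
        = (of_nat (k * (k - 1) * (2 * k - 1) * (k - 3)) :: 'k)"
      using k by (simp add: of_nat_diff)
    ultimately show False
      using k by (simp only: of_nat_eq_0_iff) simp
  qed
qed

end

section \<open>The coefficients of a filiform grading\<close>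

locale filiform_graded =
  fixes L :: "('k::field_char_0, 'v::ab_group_add) lie_alg" and G :: "nat \<Rightarrow> 'v set" and n :: nat
  assumes n3: "n \<ge> 3"
    and lie: "lie_algebra L"
    and grading: "N_grading L G"
    and dim1: "\<And>i. 1 \<le> i \<Longrightarrow> i \<le> n \<Longrightarrow> vector_space.dim (lie_scale L) (G i) = 1"
    and G_zero: "\<And>i. i > n \<Longrightarrow> G i = {0}"
    and G_succ: "\<And>i. i \<ge> 2 \<Longrightarrow> bracket_span L (G 1) (G i) = G (i + 1)"
begin

sublocale V: vector_space "lie_scale L"
  using lie by (simp add: lie_algebra_def)

abbreviation S (infixr "*\<^sub>L" 75) where "S \<equiv> lie_scale L"
abbreviation br where "br \<equiv> lie_bracket L"

lemma subspace_G: "1 \<le> i \<Longrightarrow> V.subspace (G i)"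
  using grading by (simp add: N_grading_def)

lemma span_G: "V.span (\<Union>i\<in>{1..}. G i) = lie_space L"
  using grading by (simp add: N_grading_def)

lemma G_direct:
  assumes "finite I" "I \<subseteq> {1..}" "\<And>i. i \<in> I \<Longrightarrow> x i \<in> G i" "(\<Sum>i\<in>I. x i) = 0" "i \<in> I"
  shows "x i = 0"
proof -
  have "finite I \<and> I \<subseteq> {1..} \<and> (\<forall>i\<in>I. x i \<in> G i) \<and> (\<Sum>i\<in>I. x i) = 0 \<longrightarrow> (\<forall>i\<in>I. x i = 0)"
    using grading[unfolded N_grading_def, THEN conjunct2, THEN conjunct2, THEN conjunct1] by (rule spec2)
  then show ?thesis
    using assms by simp
qed

lemma G_bracket: "1 \<le> i \<Longrightarrow> 1 \<le> j \<Longrightarrow> x \<in> G i \<Longrightarrow> y \<in> G j \<Longrightarrow> br x y \<in> G (i + j)"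
proof -
  assume *: "1 \<le> i" "1 \<le> j" "x \<in> G i" "y \<in> G j"
  have "br x y \<in> bracket_span L (G i) (G j)"
    unfolding bracket_span_def using * by (intro V.span_base) blast
  then show ?thesis
    using grading[unfolded N_grading_def, THEN conjunct2, THEN conjunct2, THEN conjunct2] *
    by (meson subsetD)
qed

lemma G_space: "1 \<le> i \<Longrightarrow> x \<in> G i \<Longrightarrow> x \<in> lie_space L"
  unfolding span_G[symmetric] by (intro V.span_base) auto

lemma subspace_L: "V.subspace (lie_space L)"
  using lie by (simp add: lie_algebra_def)

lemma
  assumes "x \<in> lie_space L" "y \<in> lie_space L"
  shows br_scale_left: "br (a *\<^sub>L x) y = a *\<^sub>L br x y"
    and br_scale_right: "br x (a *\<^sub>L y) = a *\<^sub>L br x y"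
    and br_self: "br x x = 0"
  subgoal
    using lie[unfolded lie_algebra_def, THEN conjunct2, THEN conjunct2, THEN conjunct2, THEN conjunct2, THEN conjunct1] assms
    by blast
  subgoal
    using lie[unfolded lie_algebra_def, THEN conjunct2, THEN conjunct2, THEN conjunct2, THEN conjunct2, THEN conjunct1] assms
    by blast
  subgoal
    using lie[unfolded lie_algebra_def, THEN conjunct2, THEN conjunct2, THEN conjunct2, THEN conjunct2, THEN conjunct2, THEN conjunct1] assms
    by blast
  done

lemma
  assumes "x \<in> lie_space L" "y \<in> lie_space L" "z \<in> lie_space L"
  shows br_add_left: "br (x + y) z = br x z + br y z"
    and br_add_right: "br x (y + z) = br x y + br x z"
    and br_jacobi: "br x (br y z) + br y (br z x) + br z (br x y) = 0"
  subgoal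
    using lie[unfolded lie_algebra_def, THEN conjunct2, THEN conjunct2, THEN conjunct2, THEN conjunct1] assms
    by blast
  subgoal
    using lie[unfolded lie_algebra_def, THEN conjunct2, THEN conjunct2, THEN conjunct2, THEN conjunct1] assms
    by blast
  subgoal
    using lie[unfolded lie_algebra_def, THEN conjunct2, THEN conjunct2, THEN conjunct2, THEN conjunct2, THEN conjunct2, THEN conjunct2] assms
    by blast
  done

lemma br_anti:
  assumes "x \<in> lie_space L" "y \<in> lie_space L"
  shows "br y x = - br x y"
proof -
  have s: "x + y \<in> lie_space L"
    using assms subspace_L by (simp add: V.subspace_add)
  have "0 = br (x + y) (x + y)"
    using br_self[OF s s] by simp
  also have "\<dots> = br x y + br y x"
    unfolding br_add_left[OF assms s] br_add_right[OF assms(1) assms] br_add_right[OF assms(2) assms]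
    using br_self[OF assms(1,1)] br_self[OF assms(2,2)] by simp
  finally show ?thesis
    by (simp add: eq_neg_iff_add_eq_0 add.commute)
qed

lemma br_zero:
  assumes "x \<in> lie_space L"
  shows "br x 0 = 0" "br 0 x = 0"
proof -
  have 0: "0 \<in> lie_space L"
    using subspace_L by (rule V.subspace_0)
  show "br x 0 = 0" "br 0 x = 0"
    using br_scale_right[OF assms 0, of 0] br_scale_left[OF 0 assms, of 0] by simp_all
qed

lemma br_sum:
  assumes "finite A" "\<And>a. a \<in> A \<Longrightarrow> x a \<in> lie_space L" "y \<in> lie_space L"
  shows "br (\<Sum>a\<in>A. x a) y = (\<Sum>a\<in>A. br (x a) y)" "br y (\<Sum>a\<in>A. x a) = (\<Sum>a\<in>A. br y (x a))"
proof -
  have "br (\<Sum>a\<in>A. x a) y = (\<Sum>a\<in>A. br (x a) y) \<and> br y (\<Sum>a\<in>A. x a) = (\<Sum>a\<in>A. br y (x a))"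
    using assms(1,2)
  proof (induction A)
    case empty
    then show ?case
      by (simp add: br_zero assms(3))
  next
    case (insert a A)
    have "(\<Sum>a\<in>A. x a) \<in> lie_space L"
      using insert by (intro V.subspace_sum[OF subspace_L]) auto
    then show ?case
      using insert assms(3) by (simp add: br_add_left br_add_right)
  qed
  then show "br (\<Sum>a\<in>A. x a) y = (\<Sum>a\<in>A. br (x a) y)" "br y (\<Sum>a\<in>A. x a) = (\<Sum>a\<in>A. br y (x a))"
    by auto
qed

section \<open>An adapted basis and its structure constants\<close>

lemma G_line:
  assumes "1 \<le> i" "i \<le> n"
  obtains b where "b \<noteq> 0" "G i = range (\<lambda>a. a *\<^sub>L b)"
proof -
  obtain B where B: "B \<subseteq> G i" "V.independent B" "G i \<subseteq> V.span B" "card B = V.dim (G i)"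
    using V.basis_exists by blast
  then obtain b where b: "B = {b}"
    using dim1[OF assms] by (auto simp: card_1_singleton_iff)
  have "V.span B = G i"
    using B subspace_G[OF assms(1)] by (metis V.span_minimal subset_antisym)
  then show ?thesis
    using that[of b] B(2) b by (simp add: V.span_singleton)
qed

text \<open>Generators of the first two lines are chosen and e_1 is applied repeatedly. A vanishing
  [e_1, e_i] with i < n would make the product of G 1 and G i zero, whereas it is the line G (i +
  1).\<close>

lemma basis:
  obtains e where "\<And>i. 1 \<le> i \<Longrightarrow> i \<le> n \<Longrightarrow> e i \<noteq> 0 \<and> G i = range (\<lambda>a. a *\<^sub>L e i)"
    "\<And>i. 2 \<le> i \<Longrightarrow> i < n \<Longrightarrow> br (e 1) (e i) = e (i + 1)"
proof -
  obtain e1 where e1: "e1 \<noteq> 0" "G 1 = range (\<lambda>a. a *\<^sub>L e1)"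
    using G_line[of 1] n3 by auto
  obtain e2 where e2: "e2 \<noteq> 0" "G 2 = range (\<lambda>a. a *\<^sub>L e2)"
    using G_line[of 2] n3 by auto
  define e where "e i = (if i = 1 then e1 else (br e1 ^^ (i - 2)) e2)" for i
  have e_simps: "e 1 = e1" "e 2 = e2"
    by (simp_all add: e_def)
  have e_succ: "e (i + 1) = br e1 (e i)" if "2 \<le> i" for i
  proof -
    have e: "e j = (br e1 ^^ (j - 2)) e2" if "j \<noteq> 1" for j
      unfolding e_def using that by (rule if_not_P)
    have "i + 1 - 2 = Suc (i - 2)"
      using that by simp
    then have "e (i + 1) = (br e1 ^^ Suc (i - 2)) e2"
      using e[of "i + 1"] that by (simp only:)
    then show ?thesis
      using e[of i] that by (simp only: funpow.simps o_apply)
  qed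
  have "e i \<noteq> 0 \<and> G i = range (\<lambda>a. a *\<^sub>L e i)" if "2 \<le> i" "i \<le> n" for i
    using that
  proof (induction i rule: dec_induct)
    case base
    show ?case
      unfolding e_simps using e2 by blast
  next
    case (step i)
    obtain b where b: "b \<noteq> 0" "G (Suc i) = range (\<lambda>a. a *\<^sub>L b)"
      using G_line[of "Suc i"] step.prems by (metis Suc_eq_plus1 le_add2)
    have in_G: "e1 \<in> G 1" "e i \<in> G i"
      using e1(2) step.IH step.prems V.scale_one[of e1] V.scale_one[of "e i"] by (metis Suc_leD rangeI)+
    have sp: "e1 \<in> lie_space L" "e i \<in> lie_space L"
      using G_space[OF _ in_G(1)] G_space[OF _ in_G(2)] step.hyps by auto
    have "br e1 (e i) \<in> G (Suc i)"
      using G_bracket[OF _ _ in_G] step.hyps by simp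
    then obtain s where s: "e (Suc i) = s *\<^sub>L b"
      using b(2) e_succ[OF step.hyps(1)] by auto
    have "s \<noteq> 0"
    proof
      assume "s = 0"
      then have z: "br e1 (e i) = 0"
        using s e_succ[OF step.hyps(1)] by simp
      have "br x y = 0" if "x \<in> G 1" "y \<in> G i" for x y
      proof -
        obtain a b where "x = a *\<^sub>L e1" "y = b *\<^sub>L e i"
          using e1(2) step.IH step.prems \<open>x \<in> G 1\<close> \<open>y \<in> G i\<close> by auto
        then show ?thesis
          using z sp by (simp add: br_scale_left br_scale_right V.subspace_scale[OF subspace_L])
      qed
      then have "{br x y |x y. x \<in> G 1 \<and> y \<in> G i} \<subseteq> {0}"
        by auto
      then have "V.span {br x y |x y. x \<in> G 1 \<and> y \<in> G i} \<subseteq> V.span {0}"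
        by (rule V.span_mono)
      then have "G (Suc i) \<subseteq> {0}"
        using G_succ[OF step.hyps(1)] by (simp add: bracket_span_def)
      moreover have "b \<in> G (Suc i)"
        unfolding b(2) using V.scale_one[of b] by (metis rangeI)
      ultimately have "b = 0"
        by blast
      then show False using b by simp
    qed
    moreover have "range (\<lambda>a. a *\<^sub>L s *\<^sub>L b) = range (\<lambda>a. a *\<^sub>L b)"
    proof (intro equalityI subsetI)
      fix x assume "x \<in> range (\<lambda>a. a *\<^sub>L b)"
      then obtain a where "x = a *\<^sub>L b" by blast
      then have "x = (a / s) *\<^sub>L s *\<^sub>L b"
        using \<open>s \<noteq> 0\<close> by simp
      then show "x \<in> range (\<lambda>a. a *\<^sub>L s *\<^sub>L b)" by blast
    qed auto
    ultimately show ?case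
      using s b by simp
  qed
  moreover have "e 1 \<noteq> 0 \<and> G 1 = range (\<lambda>a. a *\<^sub>L e 1)"
    unfolding e_simps using e1 by blast
  ultimately have "e i \<noteq> 0 \<and> G i = range (\<lambda>a. a *\<^sub>L e i)" if "1 \<le> i" "i \<le> n" for i
    using that by (cases "i = 1") auto
  then show ?thesis
    using that[of e] e_succ unfolding e_simps(1) by simp
qed

text \<open>Brings the bilinear expansion of a bracket into the shape of \<open>table_alg\<close>, a
  sum over i < j: the diagonal drops out and the terms with i > j are reflected.\<close>

lemma sum_antisym:
  fixes B :: "nat \<Rightarrow> nat \<Rightarrow> 'v"
  assumes "\<And>i. i \<in> {1..n} \<Longrightarrow> B i i = 0" "\<And>i j. i \<in> {1..n} \<Longrightarrow> j \<in> {1..n} \<Longrightarrow> B j i = - B i j"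
  shows "(\<Sum>i=1..n. \<Sum>j=1..n. (x i * y j) *\<^sub>L B i j) = (\<Sum>j=1..n. \<Sum>i=1..<j. (x i * y j - x j * y i) *\<^sub>L B i j)"
proof -
  let ?t = "\<lambda>i j. (x i * y j) *\<^sub>L B i j"
  have split: "(\<Sum>i=1..n. ?t i j) = (\<Sum>i=1..<j. ?t i j) + (\<Sum>i=Suc j..n. ?t i j)" if "j \<in> {1..n}" for j
  proof -
    have "{1..n} = {1..<j} \<union> {j} \<union> {Suc j..n}"
      using that by auto
    then have "(\<Sum>i=1..n. ?t i j) = (\<Sum>i\<in>{1..<j} \<union> {j}. ?t i j) + (\<Sum>i=Suc j..n. ?t i j)"
      by (simp only:) (rule sum.union_disjoint; auto)
    also have "(\<Sum>i\<in>{1..<j} \<union> {j}. ?t i j) = (\<Sum>i=1..<j. ?t i j)"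
      using assms(1)[OF that] by (subst sum.union_disjoint) auto
    finally show ?thesis .
  qed
  have swap: "(\<Sum>j=1..n. \<Sum>i=Suc j..n. ?t i j) = (\<Sum>j=1..n. \<Sum>i=1..<j. ?t j i)"
    by (subst sum.Sigma, simp, simp, subst sum.Sigma, simp, simp)
      (rule sum.reindex_bij_witness[of _ "\<lambda>(i, j). (j, i)" "\<lambda>(i, j). (j, i)"]; auto)
  have "(\<Sum>i=1..n. \<Sum>j=1..n. ?t i j) = (\<Sum>j=1..n. \<Sum>i=1..n. ?t i j)"
    by (rule sum.swap)
  also have "\<dots> = (\<Sum>j=1..n. \<Sum>i=1..<j. ?t i j) + (\<Sum>j=1..n. \<Sum>i=Suc j..n. ?t i j)"
    using split by (simp add: sum.distrib)
  also have "\<dots> = (\<Sum>j=1..n. \<Sum>i=1..<j. ?t i j + ?t j i)"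
    unfolding swap by (simp add: sum.distrib)
  also have "\<dots> = (\<Sum>j=1..n. \<Sum>i=1..<j. (x i * y j - x j * y i) *\<^sub>L B i j)"
  proof (intro sum.cong refl)
    fix i j assume ij: "j \<in> {1..n}" "i \<in> {1..<j}"
    then have "B j i = - B i j"
      by (intro assms) auto
    then show "?t i j + ?t j i = (x i * y j - x j * y i) *\<^sub>L B i j"
      by (simp add: V.scale_left_diff_distrib)
  qed
  finally show ?thesis .
qed

lemma graded_coefficients:
  obtains c where "filiform_coeffs n c" "lie_isomorphic (graded_alg n c) L"
proof -
  obtain e where eG: "\<And>i. 1 \<le> i \<Longrightarrow> i \<le> n \<Longrightarrow> e i \<noteq> 0 \<and> G i = range (\<lambda>a. a *\<^sub>L e i)"
    and e_succ: "\<And>i. 2 \<le> i \<Longrightarrow> i < n \<Longrightarrow> br (e 1) (e i) = e (i + 1)"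
    using basis by metis
  have e_in: "e i \<in> G i" if "1 \<le> i" "i \<le> n" for i
  proof -
    have "e i = 1 *\<^sub>L e i" by simp
    then show ?thesis using eG[OF that] by blast
  qed
  have e_L: "e i \<in> lie_space L" if "1 \<le> i" "i \<le> n" for i
    using that e_in G_space by blast
  have "\<exists>a. br (e i) (e j) = a *\<^sub>L e (i + j)" if "1 \<le> i" "1 \<le> j" "i + j \<le> n" for i j
    using G_bracket[OF that(1,2) e_in e_in] eG[of "i + j"] that by auto
  then obtain c0 where c0: "br (e i) (e j) = c0 i j *\<^sub>L e (i + j)" if "1 \<le> i" "1 \<le> j" "i + j \<le> n" for i j
    by metis
  \<comment> \<open>Beyond degree n the choice of \<open>c0\<close> is arbitrary; the value 0 keeps
    antisymmetry valid for all indices.\<close>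
  define c where "c i j = (if 1 \<le> i \<and> 1 \<le> j \<and> i + j \<le> n then c0 i j else 0)" for i j
  have c: "br (e i) (e j) = c i j *\<^sub>L e (i + j)" if "1 \<le> i" "1 \<le> j" "i + j \<le> n" for i j
    using c0 that by (simp add: c_def)
  have c_eqI: "a = b" if "a *\<^sub>L e i = b *\<^sub>L e i" "1 \<le> i" "i \<le> n" for a b i
    using that eG[of i] by simp
  have "filiform_coeffs n c"
  proof
    show "c i j = - c j i" for i j
    proof (cases "1 \<le> i \<and> 1 \<le> j \<and> i + j \<le> n")
      case True
      have "br (e i) (e j) = - br (e j) (e i)"
        using True by (intro br_anti e_L) auto
      then have "c i j *\<^sub>L e (i + j) = (- c j i) *\<^sub>L e (i + j)"
        using True c[of i j] c[of j i] by (simp add: add.commute)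
      then show ?thesis
        using True by (intro c_eqI) auto
    qed (auto simp: c_def)
    show "c 1 i = 1" if "2 \<le> i" "i < n" for i
    proof (rule c_eqI)
      show "c 1 i *\<^sub>L e (i + 1) = 1 *\<^sub>L e (i + 1)"
        using c[of 1 i] e_succ[OF that] that by (simp add: add.commute)
    qed (use that in auto)
    show "c j k * c i (j + k) + c k i * c j (k + i) + c i j * c k (i + j) = 0"
      if ijk: "1 \<le> i" "1 \<le> j" "1 \<le> k" "i + j + k \<le> n" for i j k
    proof (rule c_eqI)
      have nested: "br (e p) (br (e q) (e r)) = (c q r * c p (q + r)) *\<^sub>L e (i + j + k)"
        if "1 \<le> p" "1 \<le> q" "1 \<le> r" "p + q + r = i + j + k" for p q r
      proof -
        have "br (e p) (br (e q) (e r)) = c q r *\<^sub>L br (e p) (e (q + r))"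
          using that ijk by (subst c) (auto intro!: br_scale_right e_L)
        also have "br (e p) (e (q + r)) = c p (q + r) *\<^sub>L e (p + (q + r))"
          using that ijk by (intro c) auto
        also have "p + (q + r) = i + j + k"
          using that by simp
        finally show ?thesis by simp
      qed
      have "br (e i) (br (e j) (e k)) + br (e j) (br (e k) (e i)) + br (e k) (br (e i) (e j)) = 0"
        using ijk by (intro br_jacobi e_L) auto
      then show "(c j k * c i (j + k) + c k i * c j (k + i) + c i j * c k (i + j)) *\<^sub>L e (i + j + k)
          = 0 *\<^sub>L e (i + j + k)"
        using ijk nested[of i j k] nested[of j k i] nested[of k i j] by (simp add: V.scale_left_distrib)
    qed (use ijk in auto)
  qed
  moreover have "lie_isomorphic (graded_alg n c) L"
  proof -
    define f where "f x = (\<Sum>i=1..n. x i *\<^sub>L e i)" for x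
    let ?A = "lie_space (graded_alg n c)"
    have f_add: "f (x + y) = f x + f y" for x y
      by (simp add: f_def V.scale_left_distrib sum.distrib)
    have f_scale: "f (coord_scale a x) = a *\<^sub>L f x" for a x
      by (simp add: f_def coord_scale_def V.scale_sum_right)
    have f_sum: "f (\<Sum>a\<in>I. x a) = (\<Sum>a\<in>I. f (x a))" for x :: "nat \<Rightarrow> nat \<Rightarrow> 'k" and I
    proof (induction I rule: infinite_finite_induct)
      case (insert a I)
      then show ?case by (simp only: sum.insert[OF insert.hyps] f_add)
    qed (simp_all add: f_def)
    have f_basis: "f (basis_elt i) = e i" if "1 \<le> i" "i \<le> n" for i
    proof -
      have "f (basis_elt i) = (\<Sum>j=1..n. if j = i then e i else 0)"
        unfolding f_def by (intro sum.cong refl) (auto simp: basis_elt_def)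
      then show ?thesis using that by simp
    qed
    have f_L: "f x \<in> lie_space L" for x
      unfolding f_def by (intro V.subspace_sum[OF subspace_L] V.subspace_scale[OF subspace_L] e_L) auto
    have inj: "inj_on f ?A"
    proof (rule inj_onI)
      fix x y assume xy: "x \<in> ?A" "y \<in> ?A" "f x = f y"
      then have "(\<Sum>i=1..n. (x i - y i) *\<^sub>L e i) = 0"
        by (simp add: f_def V.scale_left_diff_distrib sum_subtractf)
      then have "(x i - y i) *\<^sub>L e i = 0" if "i \<in> {1..n}" for i
        using that e_in subspace_G
        by (intro G_direct[of "{1..n}" "\<lambda>i. (x i - y i) *\<^sub>L e i"]) (auto intro: V.subspace_scale)
      then have "x i = y i" for i
        using eG[of i] xy by (cases "i \<in> {1..n}") (auto simp: lie_space_graded)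
      then show "x = y" by blast
    qed
    \<comment> \<open>Surjectivity: the image is a subspace containing every G i, hence their
      span.\<close>
    have "lie_space L \<subseteq> f ` ?A"
      unfolding span_G[symmetric]
    proof (rule V.span_minimal)
      show "(\<Union>i\<in>{1..}. G i) \<subseteq> f ` ?A"
      proof
        fix v assume "v \<in> (\<Union>i\<in>{1..}. G i)"
        then obtain i where i: "1 \<le> i" "v \<in> G i" by auto
        show "v \<in> f ` ?A"
        proof (cases "i \<le> n")
          case True
          then obtain a where "v = a *\<^sub>L e i"
            using eG[of i] i by auto
          then have "v = f (coord_scale a (basis_elt i))"
            using True i by (simp add: f_scale f_basis)
          then show ?thesis
            using True i by (blast intro: lie_space_graded_scale basis_elt_in_graded)
        next
          case False
          then have "v = f 0"
            using i G_zero[of i] by (simp add: f_def)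
          then show ?thesis by (auto simp: lie_space_graded)
        qed
      qed
      show "V.subspace (f ` ?A)"
      proof (rule V.subspaceI)
        have "0 = f 0" by (simp add: f_def)
        then show "0 \<in> f ` ?A" by (auto simp: lie_space_graded)
        show "x + y \<in> f ` ?A" if "x \<in> f ` ?A" "y \<in> f ` ?A" for x y
          using that by (auto simp flip: f_add intro!: imageI lie_space_graded_add)
        show "a *\<^sub>L x \<in> f ` ?A" if "x \<in> f ` ?A" for a x
          using that by (auto simp flip: f_scale intro!: imageI lie_space_graded_scale)
      qed
    qed
    then have bij: "bij_betw f ?A (lie_space L)"
      using inj f_L by (auto simp: bij_betw_def)
    have f_bracket: "f (lie_bracket (graded_alg n c) x y) = br (f x) (f y)" for x y
    proof -
      have be: "br (e i) (e j) = f (if i + j \<le> n then coord_scale (c i j) (basis_elt (i + j)) else 0)"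
        if "i \<in> {1..n}" "j \<in> {1..n}" for i j
      proof (cases "i + j \<le> n")
        case True
        then show ?thesis
          using that c[of i j] by (simp add: f_scale f_basis)
      next
        case False
        then show ?thesis
          using that G_bracket[OF _ _ e_in e_in, of i j] G_zero[of "i + j"] by (simp add: f_def)
      qed
      have "br (f x) (f y) = (\<Sum>i=1..n. br (x i *\<^sub>L e i) (f y))"
        unfolding f_def[of x]
        by (intro br_sum f_L V.subspace_scale[OF subspace_L] e_L) auto
      also have "\<dots> = (\<Sum>i=1..n. \<Sum>j=1..n. br (x i *\<^sub>L e i) (y j *\<^sub>L e j))"
        unfolding f_def
        by (intro sum.cong refl br_sum V.subspace_scale[OF subspace_L] e_L) auto
      also have "\<dots> = (\<Sum>i=1..n. \<Sum>j=1..n. (x i * y j) *\<^sub>L br (e i) (e j))"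
        by (intro sum.cong refl)
          (simp add: br_scale_left br_scale_right e_L V.subspace_scale[OF subspace_L] mult.commute)
      also have "\<dots> = (\<Sum>j=1..n. \<Sum>i=1..<j. (x i * y j - x j * y i) *\<^sub>L br (e i) (e j))"
        using e_L by (intro sum_antisym br_self br_anti) auto
      also have "\<dots> = (\<Sum>j=1..n. \<Sum>i=1..<j. f (coord_scale (x i * y j - x j * y i)
          (if i + j \<le> n then coord_scale (c i j) (basis_elt (i + j)) else 0)))"
        by (intro sum.cong refl) (simp only: f_scale, subst be, auto)
      also have "\<dots> = f (lie_bracket (graded_alg n c) x y)"
        by (simp add: graded_alg_def table_alg_def f_sum)
      finally show ?thesis by simp
    qed
    show ?thesis
      unfolding lie_isomorphic_def using bij f_add f_scale f_bracket
      by (intro exI[of _ f]) auto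
  qed
  ultimately show ?thesis
    using that by blast
qed

end

section \<open>The classification\<close>

lemma coeff_equiv_zero_iff:
  assumes "coeff_equiv n c d" "1 \<le> i" "i < j" "i + j \<le> n"
  shows "c i j = 0 \<longleftrightarrow> d i j = 0"
proof -
  obtain \<mu> where nz: "\<And>i. i \<in> {1..n} \<Longrightarrow> \<mu> i \<noteq> 0" and eq: "c i j * \<mu> (i + j) = \<mu> i * \<mu> j * d i j"
    using assms unfolding coeff_equiv_def by blast
  have "\<mu> i \<noteq> 0" "\<mu> j \<noteq> 0" "\<mu> (i + j) \<noteq> 0"
    using assms by (intro nz; simp)+
  then show ?thesis
    using eq by auto
qed

text \<open>Normalised first rows force \<mu> i = (\<mu> 1)^(i - 2) * \<mu> 2 for i from 2 to 7.
  Hence c and d agree at (2, 3) and (3, 4) up to the common factor \<mu> 2 / (\<mu> 1)^2, and their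
  ratio is an invariant.\<close>

lemma coeff_equiv_ratio:
  assumes "coeff_equiv n c d" "7 \<le> n"
    and c1: "\<And>j. 2 \<le> j \<Longrightarrow> j < n \<Longrightarrow> c 1 j = 1" and d1: "\<And>j. 2 \<le> j \<Longrightarrow> j < n \<Longrightarrow> d 1 j = 1"
  shows "c 2 3 * d 3 4 = c 3 4 * d 2 3"
proof -
  obtain \<mu> where nz: "\<And>i. i \<in> {1..n} \<Longrightarrow> \<mu> i \<noteq> 0"
    and eq: "\<And>i j. 1 \<le> i \<Longrightarrow> i < j \<Longrightarrow> i + j \<le> n \<Longrightarrow> c i j * \<mu> (i + j) = \<mu> i * \<mu> j * d i j"
    using assms(1) unfolding coeff_equiv_def by blast
  have s: "\<mu> (j + 1) = \<mu> 1 * \<mu> j" if "2 \<le> j" "j < n" for j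
    using eq[of 1 j] c1[OF that] d1[OF that] that by (simp add: add.commute)
  have \<mu>: "\<mu> 3 = \<mu> 1 * \<mu> 2" "\<mu> 4 = \<mu> 1 * \<mu> 3" "\<mu> 5 = \<mu> 1 * \<mu> 4" "\<mu> 6 = \<mu> 1 * \<mu> 5" "\<mu> 7 = \<mu> 1 * \<mu> 6"
    using s[of 2] s[of 3] s[of 4] s[of 5] s[of 6] assms(2) by simp_all
  have nz': "\<mu> 1 \<noteq> 0" "\<mu> 2 \<noteq> 0"
    using nz assms(2) by auto
  have e23: "c 2 3 * \<mu> 5 = \<mu> 2 * \<mu> 3 * d 2 3" and e34: "c 3 4 * \<mu> 7 = \<mu> 3 * \<mu> 4 * d 3 4"
    using eq[of 2 3] eq[of 3 4] assms(2) by simp_all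
  have "\<mu> 1 * \<mu> 2 * (c 2 3 * \<mu> 1 * \<mu> 1) = \<mu> 1 * \<mu> 2 * (\<mu> 2 * d 2 3)"
    using e23 unfolding \<mu> by (simp add: ac_simps)
  then have 1: "c 2 3 * \<mu> 1 * \<mu> 1 = \<mu> 2 * d 2 3"
    using nz' by (simp only: mult_left_cancel mult_eq_0_iff simp_thms)
  have "\<mu> 1 * \<mu> 1 * \<mu> 1 * \<mu> 2 * (c 3 4 * \<mu> 1 * \<mu> 1) = \<mu> 1 * \<mu> 1 * \<mu> 1 * \<mu> 2 * (\<mu> 2 * d 3 4)"
    using e34 unfolding \<mu> by (simp add: ac_simps)
  then have 2: "c 3 4 * \<mu> 1 * \<mu> 1 = \<mu> 2 * d 3 4"
    using nz' by (simp only: mult_left_cancel mult_eq_0_iff simp_thms)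
  have "\<mu> 1 * \<mu> 1 * (c 2 3 * d 3 4) = (c 2 3 * \<mu> 1 * \<mu> 1) * d 3 4"
    by (simp only: ac_simps)
  also have "\<dots> = (c 3 4 * \<mu> 1 * \<mu> 1) * d 2 3"
    unfolding 1 2 by (simp only: ac_simps)
  finally have "\<mu> 1 * \<mu> 1 * (c 2 3 * d 3 4) = \<mu> 1 * \<mu> 1 * (c 3 4 * d 2 3)"
    by (simp only: ac_simps)
  then show ?thesis
    using nz' by (simp only: mult_left_cancel mult_eq_0_iff simp_thms)
qed

lemma coeff_equiv_scaleI:
  assumes "s \<noteq> 0" "\<And>j. 2 \<le> j \<Longrightarrow> j < n \<Longrightarrow> c 1 j = d 1 j"
    and "\<And>i j. 2 \<le> i \<Longrightarrow> i < j \<Longrightarrow> i + j \<le> n \<Longrightarrow> c i j = s * d i j"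
  shows "coeff_equiv n c d"
  unfolding coeff_equiv_def
proof (intro exI[of _ "\<lambda>i. if i = 1 then 1 else s"] conjI allI impI ballI)
  fix i j :: nat assume "1 \<le> i" "i < j" "i + j \<le> n"
  then show "c i j * (if i + j = 1 then 1 else s) = (if i = 1 then 1 else s) * (if j = 1 then 1 else s) * d i j"
    using assms(2)[of j] assms(3)[of i j] by (cases "i = 1") auto
qed (use assms(1) in auto)

section \<open>The normal form of a coefficient system\<close>

text \<open>\<open>LEAST\<close> is meaningful once some coefficient is nonzero;
  \<open>normal_form\<close> tests for that before consulting it.\<close>

definition lowest_level :: "(nat \<Rightarrow> nat \<Rightarrow> 'k::zero) \<Rightarrow> nat" where
  "lowest_level c = (LEAST N. \<exists>i j. 2 \<le> i \<and> i < j \<and> i + j = N \<and> c i j \<noteq> 0)"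

text \<open>A list member computed from c alone, so that uniqueness becomes an equation. The ratio
  of \<open>c 2 3\<close> to \<open>c 3 4\<close> is 2 + \<alpha> and survives rescaling; testing
  \<open>c 3 4\<close> first assigns the overlaps at k = 3 to \<open>g_fam\<close>.\<close>

definition normal_form :: "nat \<Rightarrow> (nat \<Rightarrow> nat \<Rightarrow> 'k::field_char_0) \<Rightarrow> ('k, nat \<Rightarrow> 'k) lie_alg" where
  "normal_form n c =
    (if 7 \<le> n \<and> c 3 4 \<noteq> 0 then if 12 \<le> n then V_alg n else g_fam n (c 2 3 / c 3 4 - 2)
     else if 5 \<le> n \<and> c 2 3 \<noteq> 0 then m2 n
     else if \<forall>i j. 2 \<le> i \<longrightarrow> i < j \<longrightarrow> i + j \<le> n \<longrightarrow> c i j = 0 then m0 n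
     else if n = lowest_level c then m01 (n div 2)
     else if n = lowest_level c + 1 then m02 (n div 2 - 1)
     else m03 (n div 2 - 1))"

lemma lowest_level_eqI:
  assumes "2 \<le> i" "i < j" "i + j = N" "c i j \<noteq> 0"
    and "\<And>i j. 2 \<le> i \<Longrightarrow> i < j \<Longrightarrow> i + j < N \<Longrightarrow> c i j = 0"
  shows "lowest_level c = N"
  unfolding lowest_level_def
  by (rule Least_equality) (use assms in \<open>auto simp: linorder_not_less[symmetric]\<close>)

text \<open>The members with k = 3 are members of the g families with \<alpha> = -2 and are treated
  there, so the three m sequences start at k = 4.\<close>

lemma filiform_list_cases:
  assumes "\<hh> \<in> filiform_list"
  obtains (m0) n where "\<hh> = m0 n" "3 \<le> n"
    | (m2) n where "\<hh> = m2 n" "5 \<le> n"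
    | (V) n where "\<hh> = V_alg n" "12 \<le> n"
    | (m01) k where "\<hh> = m01 k" "4 \<le> k"
    | (m02) k where "\<hh> = m02 k" "4 \<le> k"
    | (m03) k where "\<hh> = m03 k" "4 \<le> k"
    | (g) n \<alpha> where "\<hh> = g_fam n \<alpha>" "7 \<le> n" "n \<le> 11"
proof -
  have g': thesis if "\<hh> = g_fam m \<alpha>" "m \<in> {7..11}" for m \<alpha>
    using g[OF that(1)] that(2) by simp
  have m01': thesis if "\<hh> = m01 k" "3 \<le> k" for k
  proof (cases "k = 3")
    case True
    then show ?thesis
      using that(1) by (intro g'[of 7 "- 2"]) (simp_all add: filiform_list_overlaps)
  qed (use that in \<open>intro m01[of k], auto\<close>)
  have m02': thesis if "\<hh> = m02 k" "3 \<le> k" for k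
  proof (cases "k = 3")
    case True
    then show ?thesis
      using that(1) by (intro g'[of 8 "- 2"]) (simp_all add: filiform_list_overlaps)
  qed (use that in \<open>intro m02[of k], auto\<close>)
  have m03': thesis if "\<hh> = m03 k" "3 \<le> k" for k
  proof (cases "k = 3")
    case True
    then show ?thesis
      using that(1) by (intro g'[of 9 "- 2"]) (simp_all add: filiform_list_overlaps)
  qed (use that in \<open>intro m03[of k], auto\<close>)
  have "(\<exists>n. \<hh> = m0 n \<and> 3 \<le> n) \<or> (\<exists>n. \<hh> = m2 n \<and> 5 \<le> n) \<or> (\<exists>n. \<hh> = V_alg n \<and> 12 \<le> n)
    \<or> (\<exists>k. \<hh> = m01 k \<and> 3 \<le> k) \<or> (\<exists>k. \<hh> = m02 k \<and> 3 \<le> k) \<or> (\<exists>k. \<hh> = m03 k \<and> 3 \<le> k)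
    \<or> (\<exists>\<alpha>. \<hh> = g_fam 7 \<alpha> \<or> \<hh> = g_fam 8 \<alpha> \<or> \<hh> = g_fam 9 \<alpha> \<or> \<hh> = g_fam 10 \<alpha> \<or> \<hh> = g_fam 11 \<alpha>)"
    using assms unfolding filiform_list_def Un_iff mem_Collect_eq by blast
  then show ?thesis
    by (elim disjE exE conjE)
      (rule m0 m2 V m01' m02' m03', assumption, assumption | rule g', assumption, simp)+
qed

context filiform_coeffs begin

lemma isomorphic_list_coeffs:
  assumes "3 \<le> n" "3 \<le> m" and iso: "lie_isomorphic (graded_alg n c) (graded_alg m d)"
    and d1: "\<And>j. 2 \<le> j \<Longrightarrow> j < m \<Longrightarrow> d 1 j \<noteq> 0"
  shows "n = m" "4 \<le> n \<Longrightarrow> coeff_equiv n c d"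
    "2 \<le> i \<Longrightarrow> i < j \<Longrightarrow> i + j \<le> n \<Longrightarrow> c i j = 0 \<longleftrightarrow> d i j = 0"
proof -
  have c1: "c 1 i \<noteq> 0" if "2 \<le> i" "i < n" for i
    using one[OF that] by simp
  show "n = m" and *: "4 \<le> n \<Longrightarrow> coeff_equiv n c d"
    using graded_isomorphic_coeff_equiv[OF iso assms(1,2) c1 d1] by blast+
  \<comment> \<open>The index bounds give i + j \<ge> 5, which supplies the dimension bound of
    \<open>*\<close>.\<close>
  show "c i j = 0 \<longleftrightarrow> d i j = 0" if "2 \<le> i" "i < j" "i + j \<le> n"
    using coeff_equiv_zero_iff[OF *, of i j] that by simp
qed

text \<open>k \<ge> 4 places \<open>c 2 3\<close> and \<open>c 3 4\<close>, of levels 5 and 7, below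
  level 2k + 1, so the earlier branches of \<open>normal_form\<close> are skipped.\<close>

lemma normal_form_levels:
  assumes k: "4 \<le> k" and n: "2 * k + 1 \<le> n" "n \<le> 2 * k + 3"
    and low: "\<And>i j. 2 \<le> i \<Longrightarrow> i < j \<Longrightarrow> i + j < 2 * k + 1 \<Longrightarrow> c i j = 0"
    and top: "c k (k + 1) \<noteq> 0"
  shows "normal_form n c = (if n = 2 * k + 1 then m01 k else if n = 2 * k + 2 then m02 k else m03 k)"
proof -
  have L: "lowest_level c = 2 * k + 1"
    using k low top by (intro lowest_level_eqI[of k "k + 1"]) auto
  have c0: "c 2 3 = 0" "c 3 4 = 0"
    using k by (auto intro!: low)
  have nz: "(\<forall>i j. 2 \<le> i \<longrightarrow> i < j \<longrightarrow> i + j \<le> n \<longrightarrow> c i j = 0) = False"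
  proof -
    have "2 \<le> k" "k < k + 1" "k + (k + 1) \<le> n"
      using k n by auto
    then show ?thesis
      using top by blast
  qed
  consider "n = 2 * k + 1" | "n = 2 * k + 2" | "n = 2 * k + 3"
    using n by linarith
  then show ?thesis
    unfolding normal_form_def L c0 nz by cases simp_all
qed

section \<open>Uniqueness and existence of the list member\<close>

text \<open>An isomorphism preserves the dimension and the set of vanishing coefficients, which
  determine the branch of \<open>normal_form\<close>; inside a g family the invariant ratio recovers
  \<alpha>.\<close>

lemma isomorphic_list_unique:
  assumes n: "3 \<le> n" and h: "\<hh> \<in> filiform_list" and iso: "lie_isomorphic (graded_alg n c) \<hh>"
  shows "\<hh> = normal_form n c"
  using h
proof (cases rule: filiform_list_cases)
  case (m0 m)
  note * = isomorphic_list_coeffs[OF n _ iso[unfolded m0(1) m0_def]]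
  have nm: "n = m"
    using m0 by (intro *(1)) auto
  have "c i j = 0" if "2 \<le> i" "i < j" "i + j \<le> n" for i j
    using *(3)[of i j] m0 that by simp
  moreover from this have "5 \<le> n \<Longrightarrow> c 2 3 = 0" "7 \<le> n \<Longrightarrow> c 3 4 = 0"
    by simp_all
  ultimately show ?thesis
    using m0 nm by (auto simp: normal_form_def)
next
  case (m2 m)
  note * = isomorphic_list_coeffs[OF n _ iso[unfolded m2(1) m2_def]]
  have nm: "n = m"
    using m2 by (intro *(1)) auto
  have "c 2 3 \<noteq> 0" "7 \<le> n \<Longrightarrow> c 3 4 = 0"
    using *(3)[of 2 3] *(3)[of 3 4] m2 nm by simp_all
  then show ?thesis
    using m2 nm by (auto simp: normal_form_def)
next
  case (V m)
  note * = isomorphic_list_coeffs[OF n _ iso[unfolded V(1) V_alg_def]]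
  have nm: "n = m"
    using V by (intro *(1)) auto
  have "c 3 4 \<noteq> 0"
    using *(3)[of 3 4] V nm by simp
  then show ?thesis
    using V nm by (simp add: normal_form_def)
next
  case (m01 k)
  note * = isomorphic_list_coeffs[OF n _ iso[unfolded m01(1) m01_def]]
  have nm: "n = 2 * k + 1"
    using m01 by (intro *(1)) auto
  have "c i j = 0" if "2 \<le> i" "i < j" "i + j < 2 * k + 1" for i j
    using *(3)[of i j] m01 that nm by auto
  moreover have "c k (k + 1) \<noteq> 0"
    using *(3)[of k "k + 1"] m01 nm by auto
  ultimately show ?thesis
    using m01 nm by (subst normal_form_levels[of k]) auto
next
  case (m02 k)
  note * = isomorphic_list_coeffs[OF n _ iso[unfolded m02(1) m02_def]]
  have nm: "n = 2 * k + 2"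
    using m02 by (intro *(1)) auto
  have "c i j = 0" if "2 \<le> i" "i < j" "i + j < 2 * k + 1" for i j
    using *(3)[of i j] m02 that nm by auto
  moreover have "c k (k + 1) \<noteq> 0"
    using *(3)[of k "k + 1"] m02 nm by auto
  ultimately show ?thesis
    using m02 nm by (subst normal_form_levels[of k]) auto
next
  case (m03 k)
  note * = isomorphic_list_coeffs[OF n _ iso[unfolded m03(1) m03_def]]
  have nm: "n = 2 * k + 3"
    using m03 by (intro *(1)) auto
  have "c i j = 0" if "2 \<le> i" "i < j" "i + j < 2 * k + 1" for i j
    using *(3)[of i j] m03 that nm by auto
  moreover have "c k (k + 1) \<noteq> 0"
    using *(3)[of k "k + 1"] m03 nm by auto
  ultimately show ?thesis
    using m03 nm by (subst normal_form_levels[of k]) auto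
next
  case (g m \<alpha>)
  note * = isomorphic_list_coeffs[OF n _ iso[unfolded g(1) g_fam_def]]
  have g1: "g_coeff \<alpha> 1 j = 1" for j
    by (simp add: g_coeff_def)
  have nm: "n = m"
    using g g1 by (intro *(1)) auto
  have e: "coeff_equiv n c (g_coeff \<alpha>)"
    using g nm g1 by (intro *(2)) auto
  have g34: "g_coeff \<alpha> 3 4 = 1" "g_coeff \<alpha> 2 3 = 2 + \<alpha>"
    by (simp_all add: g_coeff_def)
  have "c 3 4 \<noteq> 0"
    using coeff_equiv_zero_iff[OF e, of 3 4] g nm g34 by simp
  moreover have "c 2 3 = c 3 4 * (2 + \<alpha>)"
    using coeff_equiv_ratio[OF e] g nm one g1 g34 by simp
  ultimately show ?thesis
    using g nm by (simp add: normal_form_def)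
qed


lemma unscale:
  assumes "s \<noteq> 0" "2 \<le> i" "i < j" and "(if i = 1 \<or> j = 1 then c i j else 1 / s * c i j) = x"
  shows "c i j = s * x"
proof -
  have "x = 1 / s * c i j"
    using assms(2-4) by simp
  then show ?thesis
    using assms(1) by simp
qed

text \<open>In every branch with a nonzero coefficient outside the first row, c is rescaled to a
  normalised system, the level computations apply, and the rescaling is undone by a diagonal change
  of basis.\<close>

lemma normal_form_isomorphic:
  assumes n: "3 \<le> n"
  shows "normal_form n c \<in> filiform_list" "lie_isomorphic (graded_alg n c) (normal_form n c)"
proof -
  let ?scaled = "\<lambda>s i j. if i = 1 \<or> j = 1 then c i j else s * c i j"
  consider (V) "12 \<le> n" "c 3 4 \<noteq> 0" | (g) "7 \<le> n" "n \<le> 11" "c 3 4 \<noteq> 0"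
    | (m2) "7 \<le> n \<Longrightarrow> c 3 4 = 0" "5 \<le> n" "c 2 3 \<noteq> 0"
    | (m0) "7 \<le> n \<Longrightarrow> c 3 4 = 0" "5 \<le> n \<Longrightarrow> c 2 3 = 0" "\<forall>i j. 2 \<le> i \<longrightarrow> i < j \<longrightarrow> i + j \<le> n \<longrightarrow> c i j = 0"
    | (levels) i j where "7 \<le> n \<Longrightarrow> c 3 4 = 0" "5 \<le> n \<Longrightarrow> c 2 3 = 0" "2 \<le> i" "i < j" "i + j \<le> n" "c i j \<noteq> 0"
  proof -
    have "12 \<le> n \<or> n \<le> 11"
      by linarith
    then show ?thesis
      using V g m2 m0 levels by blast
  qed
  then have "normal_form n c \<in> filiform_list \<and> lie_isomorphic (graded_alg n c) (normal_form n c)"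
  proof cases
    case V
    define y where "y = c 3 4"
    interpret d: filiform_coeffs n "?scaled (1 / y)"
      using V by (intro scaled) (auto simp: y_def)
    have y: "y \<noteq> 0" using V by (simp add: y_def)
    have cW: "c i j = y * Witt_coeff i j" if "2 \<le> i" "i < j" "i + j \<le> n" for i j
    proof (rule unscale[OF y that(1,2)], rule d.Witt)
      show "?scaled (1 / y) 3 4 = 1"
        using y by (simp add: y_def)
    qed (use V that in auto)
    have "coeff_equiv n c (\<lambda>i j. of_nat j - of_nat i)"
      unfolding coeff_equiv_def
    \<comment> \<open>The factors 60 * (i - 2)! come from the basis behind
      \<open>Witt_coeff\<close>; y restores the original size of \<open>c 3 4\<close>.\<close>
    proof (intro exI[of _ "\<lambda>i. if i = 1 then 1 else 60 * y * fact (i - 2)"] conjI allI impI ballI)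
      fix i j :: nat assume ij: "1 \<le> i" "i < j" "i + j \<le> n"
      show "c i j * (if i + j = 1 then 1 else 60 * y * fact (i + j - 2)) =
        (if i = 1 then 1 else 60 * y * fact (i - 2)) * (if j = 1 then 1 else 60 * y * fact (j - 2)) *
        (of_nat j - of_nat i)"
      proof (cases "i = 1")
        case True
        then obtain q where q: "j = q + 2"
          using ij le_Suc_ex[of 2 j] by (auto simp: add.commute)
        then show ?thesis
          using True one[of j] ij by (simp add: algebra_simps)
      next
        case False
        then show ?thesis
          using ij cW[of i j] by (simp add: Witt_coeff_def)
      qed
    qed (use V in \<open>auto simp: y_def\<close>)
    then have "lie_isomorphic (graded_alg n c) (V_alg n)"
      unfolding V_alg_def by (rule coeff_equiv_isomorphic)
    moreover have "V_alg n \<in> filiform_list"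
      using V unfolding filiform_list_def by blast
    moreover have "normal_form n c = V_alg n"
      using V by (simp add: normal_form_def)
    ultimately show ?thesis by simp
  next
    case g
    define y where "y = c 3 4"
    define a where "a = c 2 3 / y - 2"
    have y: "y \<noteq> 0" using g by (simp add: y_def)
    interpret d: filiform_coeffs n "?scaled (1 / y)"
      by (intro scaled) (use y in auto)
    have d34: "?scaled (1 / y) 3 4 = 1" and a: "a = ?scaled (1 / y) 2 3 - 2"
      using y by (simp_all add: y_def a_def)
    have gg: "?scaled (1 / y) i j = g_coeff a i j" if "1 \<le> i" "i < j" "i + j \<le> n" for i j
    proof -
      consider "n \<le> 8" | "9 \<le> n" "n \<le> 10" | "n = 11"
        using g by linarith
      then show ?thesis
      proof cases
        case 1
        show ?thesis
          by (rule d.g_coeff_8[OF d34 a that]) (use that 1 in linarith)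
      next
        case 2
        show ?thesis
          by (rule d.g_coeff_10(2)[OF _ d34 a that]) (use that 2 in linarith)+
      next
        case 3
        show ?thesis
          by (rule d.g_coeff_11[OF _ d34 a that]) (use that 3 in linarith)+
      qed
    qed
    have cg: "c i j = y * g_coeff a i j" if "2 \<le> i" "i < j" "i + j \<le> n" for i j
      by (rule unscale[OF y that(1,2)], rule gg) (use that in auto)
    have "coeff_equiv n c (g_coeff a)"
      by (rule coeff_equiv_scaleI[OF y]) (use one cg in \<open>auto simp: g_coeff_def\<close>)
    then have "lie_isomorphic (graded_alg n c) (g_fam n a)"
      unfolding g_fam_def by (rule coeff_equiv_isomorphic)
    moreover have "g_fam n a \<in> filiform_list"
    proof -
      \<comment> \<open>The parameter restrictions of the list are consequences of the Jacobi
        identities of degrees 9 and 11.\<close>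
      have 9: "a \<noteq> - (5 / 2)" if "9 \<le> n"
      proof
        assume "a = - (5 / 2)"
        moreover have "2 * a + 5 \<noteq> 0"
          by (rule d.g_coeff_10(1)[OF that d34 a, of 1 2]) (use that in auto)
        ultimately show False by simp
      qed
      have 11: "a \<noteq> - 1" "a \<noteq> - 3" if "11 \<le> n"
        using d.relation_11(2)[OF that d34 a] by auto
      consider "n = 7" | "n = 8" | "n = 9" | "n = 10" | "n = 11"
        using g by linarith
      then show ?thesis
        unfolding filiform_list_def using 9 11 by cases auto
    qed
    moreover have "normal_form n c = g_fam n a"
      using g by (simp add: normal_form_def a_def y_def)
    ultimately show ?thesis by simp
  next
    case m2
    define x where "x = c 2 3"
    have x: "x \<noteq> 0" using m2 by (simp add: x_def)
    interpret d: filiform_coeffs n "?scaled (1 / x)"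
      by (intro scaled) (use x in auto)
    have cm: "c i j = x * (if i = 2 then 1 else 0)" if "2 \<le> i" "i < j" "i + j \<le> n" for i j
      by (rule unscale[OF x that(1,2)], rule d.m2_coeff[OF _ _ that]) (use m2 x in \<open>auto simp: x_def\<close>)
    have "coeff_equiv n c (\<lambda>i j. if i = 1 then 1 else if i = 2 then 1 else 0)"
      by (rule coeff_equiv_scaleI[OF x]) (use one cm in auto)
    then have "lie_isomorphic (graded_alg n c) (m2 n)"
      unfolding m2_def by (rule coeff_equiv_isomorphic)
    moreover have "m2 n \<in> filiform_list"
      using m2 unfolding filiform_list_def by blast
    moreover have "normal_form n c = m2 n"
      using m2 by (auto simp: normal_form_def)
    ultimately show ?thesis by simp
  next
    case m0
    have "coeff_equiv n c (\<lambda>i j. if i = 1 then 1 else 0)"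
      by (rule coeff_equiv_scaleI[of 1]) (use one m0(3) in auto)
    then have "lie_isomorphic (graded_alg n c) (m0 n)"
      unfolding m0_def by (rule coeff_equiv_isomorphic)
    moreover have "m0 n \<in> filiform_list"
      using n unfolding filiform_list_def by blast
    moreover have "normal_form n c = m0 n"
      using m0 by (auto simp: normal_form_def)
    ultimately show ?thesis by simp
  next
    case (levels i j)
    define P where "P N \<longleftrightarrow> (\<exists>i j. 2 \<le> i \<and> i < j \<and> i + j = N \<and> c i j \<noteq> 0)" for N
    define M where "M = (LEAST N. P N)"
    have Pij: "P (i + j)"
      using levels unfolding P_def by blast
    have PM: "P M" and M: "M \<le> n"
      using LeastI[of P, OF Pij] Least_le[of P, OF Pij] levels unfolding M_def by auto
    obtain p q where pq: "2 \<le> p" "p < q" "p + q = M" "c p q \<noteq> 0"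
      using PM unfolding P_def by blast
    have low': "c i j = 0" if "2 \<le> i" "i < j" "i + j < M" for i j
      using not_less_Least[of "i + j" P] that unfolding P_def M_def by blast
    have low: "c i j = 0" if "2 \<le> i" "2 \<le> j" "i + j < M" for i j
      using low'[of i j] low'[of j i] anti[of i j] that by (cases i j rule: linorder_cases) auto
    have "2 \<le> q"
      using pq by simp
    note level = lowest_level_odd[OF M low pq(1) this pq(3,4)]
    obtain k where k: "M = 2 * k + 1"
      using level(1) by (auto elim: oddE)
    note Mi = level(2)
    have top: "c 2 (M - 2) \<noteq> 0"
      using Mi[of p] pq by auto
    \<comment> \<open>Level 5 consists of \<open>c 2 3\<close>, and at level 7 the alternation gives
      \<open>c 2 5 = - c 3 4\<close>; both are 0 in this branch.\<close>
    have "k \<noteq> 2"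
      using top levels(2) M k by auto
    moreover have "k \<noteq> 3"
      using top levels(1) M k Mi[of 3] by auto
    moreover have "2 \<le> k"
      using pq k by simp
    ultimately have k4: "4 \<le> k"
      by simp
    define s where "s = - c 2 (2 * k - 1)"
    have s2: "2 * k + 1 - 2 = 2 * k - 1" by simp
    have s: "s \<noteq> 0"
      using top unfolding s_def k s2 by simp
    interpret d: filiform_coeffs n "?scaled (1 / s)"
      by (intro scaled) (use s in auto)
    have kn: "2 * k + 1 \<le> n"
      using M k by simp
    have dlow: "?scaled (1 / s) i j = 0" if "2 \<le> i" "2 \<le> j" "i + j < 2 * k + 1" for i j
      using low[of i j] that k by auto
    have dtop: "?scaled (1 / s) 2 (2 * k - 1) = - 1"
      using s k4 by (auto simp: s_def)
    note L = d.m0_levels[OF k4 kn dlow dtop]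
    have n3: "n \<le> 2 * k + 3"
      using L(4) by blast
    have e: "c i j = s * x" if "?scaled (1 / s) i j = x" "2 \<le> i" "i < j" for i j x
      using unscale[OF s that(2,3,1)] .
    have c1: "c i j = s * (-1) ^ (i + 1)" if "2 \<le> i" "i < j" "i + j = 2 * k + 1" for i j
    proof -
      have "j = 2 * k + 1 - i" "i < 2 * k" using that by auto
      then show ?thesis using L(1)[of i] that by (intro e) auto
    qed
    have c2: "c i j = s * ((-1) ^ (i + 1) * (of_nat k - of_nat i + 1))"
      if "2 \<le> i" "i < j" "i + j = 2 * k + 2" "2 * k + 2 \<le> n" for i j
    proof -
      have "j = 2 * k + 2 - i" "i \<le> 2 * k" using that by auto
      then show ?thesis using L(2)[of i] that by (intro e) auto
    qed
    have c3: "c i j = s * ((-1) ^ i * ((of_nat i - 2) * of_nat k - (of_nat i - 2) * (of_nat i - 1) / 2))"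
      if "2 \<le> i" "i < j" "i + j = 2 * k + 3" "2 * k + 3 \<le> n" for i j
    proof -
      have "j = 2 * k + 3 - i" "i \<le> 2 * k + 1" using that by auto
      then show ?thesis using L(3)[of i] that by (intro e) auto
    qed
    have c0: "c i j = 0" if "2 \<le> i" "i < j" "i + j < 2 * k + 1" for i j
      using low'[of i j] that k by simp
    have "c k (k + 1) \<noteq> 0"
      using c1[of k "k + 1"] k4 s by simp
    then have nf: "normal_form n c = (if n = 2 * k + 1 then m01 k else if n = 2 * k + 2 then m02 k else m03 k)"
      using k4 kn n3 c0 by (intro normal_form_levels)
    consider "n = 2 * k + 1" | "n = 2 * k + 2" | "n = 2 * k + 3"
      using kn n3 by linarith
    then show ?thesis
    proof cases
      case 1
      have "lie_isomorphic (graded_alg n c) (m01 k)"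
        unfolding m01_def 1
      proof (intro coeff_equiv_isomorphic coeff_equiv_scaleI[OF s])
        fix i j assume ij: "2 \<le> i" "i < j" "i + j \<le> 2 * k + 1"
        then consider "i + j < 2 * k + 1" | "i + j = 2 * k + 1" by linarith
        then show "c i j = s * (if i = 1 then 1 else if i \<in> {2..k} \<and> j = 2 * k + 1 - i then (- 1) ^ (i + 1) else 0)"
          by cases (use ij c0[of i j] c1[of i j] in auto)
      qed (use one 1 in auto)
      moreover have "m01 k \<in> filiform_list"
        using k4 unfolding filiform_list_def by fastforce
      ultimately show ?thesis
        using nf 1 by simp
    next
      case 2
      have "lie_isomorphic (graded_alg n c) (m02 k)"
        unfolding m02_def 2
      proof (intro coeff_equiv_isomorphic coeff_equiv_scaleI[OF s])
        fix i j assume ij: "2 \<le> i" "i < j" "i + j \<le> 2 * k + 2"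
        then consider "i + j < 2 * k + 1" | "i + j = 2 * k + 1" | "i + j = 2 * k + 2" by linarith
        then show "c i j = s * (if i = 1 then 1 else if i \<in> {2..k} \<and> j = 2 * k + 1 - i then (- 1) ^ (i + 1)
            else if i \<in> {2..k} \<and> j = 2 * k + 2 - i then (- 1) ^ (i + 1) * (of_nat k - of_nat i + 1) else 0)"
          by cases (use ij 2 c0[of i j] c1[of i j] c2[of i j] in auto)
      qed (use one 2 in auto)
      moreover have "m02 k \<in> filiform_list"
        using k4 unfolding filiform_list_def by fastforce
      ultimately show ?thesis
        using nf 2 by simp
    next
      case 3
      have "lie_isomorphic (graded_alg n c) (m03 k)"
        unfolding m03_def 3
      proof (intro coeff_equiv_isomorphic coeff_equiv_scaleI[OF s])
        fix i j assume ij: "2 \<le> i" "i < j" "i + j \<le> 2 * k + 3"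
        \<comment> \<open>The list states the level 2k + 3 brackets only from i = 3 on; at i = 2 the
          formula of \<open>c3\<close> gives 0.\<close>
        have i2: "i = 2 \<or> i \<in> {3..k + 1}" using ij by auto
        from ij consider "i + j < 2 * k + 1" | "i + j = 2 * k + 1" | "i + j = 2 * k + 2" | "i + j = 2 * k + 3" by linarith
        then show "c i j = s * (if i = 1 then 1 else if i \<in> {2..k} \<and> j = 2 * k + 1 - i then (- 1) ^ (i + 1)
            else if i \<in> {2..k} \<and> j = 2 * k + 2 - i then (- 1) ^ (i + 1) * (of_nat k - of_nat i + 1)
            else if i \<in> {3..k + 1} \<and> j = 2 * k + 3 - i then
              (- 1) ^ i * ((of_nat i - 2) * of_nat k - (of_nat i - 2) * (of_nat i - 1) / 2)
            else 0)"
          by cases (use i2 ij 3 c0[of i j] c1[of i j] c2[of i j] c3[of i j] in auto)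
      qed (use one 3 in auto)
      moreover have "m03 k \<in> filiform_list"
        using k4 unfolding filiform_list_def by fastforce
      ultimately show ?thesis
        using nf 3 by simp
    qed
  qed
  then show "normal_form n c \<in> filiform_list" "lie_isomorphic (graded_alg n c) (normal_form n c)"
    by auto
qed

end

theorem theorem5p17:
  fixes \<gg> :: "('k::field_char_0, 'v::ab_group_add) lie_alg"
    and G :: "nat \<Rightarrow> 'v set"
    and n :: nat
  assumes "n \<ge> 3"
    and "lie_algebra \<gg>"
    and "N_grading \<gg> G"
    and "\<And>i. 1 \<le> i \<Longrightarrow> i \<le> n \<Longrightarrow> vector_space.dim (lie_scale \<gg>) (G i) = 1"
    and "\<And>i. i > n \<Longrightarrow> G i = {0}"
    and "\<And>i. i \<ge> 2 \<Longrightarrow> bracket_span \<gg> (G 1) (G i) = G (i + 1)"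
  shows "\<exists>!\<hh>. \<hh> \<in> filiform_list \<and> lie_isomorphic \<gg> \<hh>"
proof -
  interpret filiform_graded \<gg> G n
    by (rule filiform_graded.intro) (use assms in auto)
  obtain c where c: "filiform_coeffs n c" and iso: "lie_isomorphic (graded_alg n c) \<gg>"
    by (rule graded_coefficients)
  interpret filiform_coeffs n c
    by (rule c)
  show ?thesis
  proof (rule ex1I[of _ "normal_form n c"])
    \<comment> \<open>\<open>iso\<close> runs from the coefficient algebra to \<open>\<gg>\<close>:
      it is inverted for existence and composed as it stands for uniqueness.\<close>
    show "normal_form n c \<in> filiform_list \<and> lie_isomorphic \<gg> (normal_form n c)"
      using normal_form_isomorphic[OF assms(1)] lie_isomorphic_graded_sym[OF iso] lie_isomorphic_trans by blast
    show "\<hh> = normal_form n c" if "\<hh> \<in> filiform_list \<and> lie_isomorphic \<gg> \<hh>" for \<hh>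
      using that isomorphic_list_unique[OF assms(1)] lie_isomorphic_trans[OF iso] by blast
  qed
qed

end
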